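(* Let $k\in\mathbb{Z}^+$, let $\mathbb{H}_k = \{(z_1,z_2)\in\mathbb{C}^2 : |z_1|^k < |z_2| < 1\}$, let $\mathbb{B}_k$ be the Bergman kernel of $\mathbb{H}_k$, and let $\delta_k(z)$ be the Euclidean distance from $z\in\mathbb{H}_k$ to the boundary $b\mathbb{H}_k$. Then $$\mathbb{B}_k(z,z)\approx \delta_k(z)^{-2}\qquad\text{as } z\to 0;$$ that is, there are constants $K\ge 1$ and $r>0$ (which may depend on $k$) such that for all $z\in\mathbb{H}_k$ with $\|z\|<r$, $$K^{-1}\,\delta_k(z)^{-2}\le \mathbb{B}_k(z,z)\le K\,\delta_k(z)^{-2}.$$
   Context: For a domain $\Omega\subset\mathbb{C}^n$, the Bergman space $A^2(\Omega)$ is the Hilbert space of holomorphic functions on $\Omega$ that are square-integrable with respect to Lebesgue measure $dV$. The Bergman kernel of $\Omega$ is the function $\mathbb{B}_\Omega:\Omega\times\Omega\to\mathbb{C}$, given by the Riesz representation theorem, such that $\overline{\mathbb{B}_\Omega(z,\cdot)}\in A^2(\Omega)$ for each $z\in\Omega$ and $f(z)=\int_\Omega \mathbb{B}_\Omega(z,w)f(w)\,dV(w)$ for all $f\in A^2(\Omega)$, $z\in\Omega$. The distance to the boundary is $\delta_\Omega(z)=\min\{\|z-\zeta\|:\zeta\in b\Omega\}$, where $\|\cdot\|$ is the Euclidean norm and $b\Omega$ the topological boundary. The notation $A\lesssim B$ means there is a constant $K>0$, independent of the relevant variables (here, of $z$), with $A\le K\cdot B$; $A\approx B$ means $A\lesssim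 B\lesssim A$. *)

theory Defs
  imports "HOL-Analysis.Analysis"
begin

text \<open>
  Complex \<open>n\<close>-space is \<^typ>\<open>complex ^ 'n\<close>; its library norm is the Euclidean norm and
  \<^term>\<open>lborel\<close> on it is \<open>2n\<close>-dimensional Lebesgue measure.
\<close>

text \<open>
  Holomorphy in several variables: complex Frechet differentiability at every point. It is
  meant for open sets. (The real derivative provided by the library must be
  complex-linear.)
\<close>

definition holomorphic_several :: "(complex ^ 'n) set \<Rightarrow> (complex ^ 'n \<Rightarrow> complex) \<Rightarrow> bool" where
  "holomorphic_several \<Omega> f \<longleftrightarrow>
     (\<forall>z\<in>\<Omega>. \<exists>f'. (f has_derivative f') (at z) \<and> (\<forall>c v. f' (c *s v) = c * f' v))"

text \<open>
  Functions are total, so an element of the Bergman space is represented by any of its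
  extensions to the whole space; only the values on \<open>\<Omega>\<close> matter.
\<close>

definition bergman_space :: "(complex ^ 'n) set \<Rightarrow> (complex ^ 'n \<Rightarrow> complex) set" where
  "bergman_space \<Omega> =
     {f. holomorphic_several \<Omega> f \<and> set_integrable lborel \<Omega> (\<lambda>z. (norm (f z))\<^sup>2)}"

text \<open>
  For \<open>z \<in> \<Omega>\<close>, the slice \<open>B(z, \<cdot>)\<close> is the unique function on \<open>\<Omega>\<close> whose conjugate lies in the
  Bergman space and which reproduces evaluation at \<open>z\<close>. Extending it by \<open>0\<close> off \<open>\<Omega>\<close> makes it
  unique as a total function, as the definite description requires.
\<close>

definition bergman_kernel :: "(complex ^ 'n) set \<Rightarrow> complex ^ 'n \<Rightarrow> complex ^ 'n \<Rightarrow> complex" where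
  "bergman_kernel \<Omega> z =
     (THE g. (\<forall>w. w \<notin> \<Omega> \<longrightarrow> g w = 0) \<and>
             (\<lambda>w. cnj (g w)) \<in> bergman_space \<Omega> \<and>
             (\<forall>f\<in>bergman_space \<Omega>. f z = set_lebesgue_integral lborel \<Omega> (\<lambda>w. g w * f w)))"

definition boundary_distance :: "(complex ^ 'n) set \<Rightarrow> complex ^ 'n \<Rightarrow> real" where
  "boundary_distance \<Omega> z = infdist z (frontier \<Omega>)"

definition hartogs_triangle :: "nat \<Rightarrow> (complex ^ 2) set" where
  "hartogs_triangle k = {z. norm (z $ 1) ^ k < norm (z $ 2) \<and> norm (z $ 2) < 1}"

end

theory Submission
  imports Defs "HOL-Complex_Analysis.Conformal_Mappings"
begin

text \<open>
The Bergman kernel on the diagonal is an extremal quantity: \<open>B(z,z)\<close> is the least constant \<open>A\<close> with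
\<open>|f z|\<^sup>2 \<le> A \<parallel>f\<parallel>\<^sup>2\<close> for every \<open>f\<close> in the Bergman space (\<open>bergman_kernel_diagonal\<close>). An upper bound
for the kernel is thus an inequality for all \<open>f\<close>, and a lower bound is one good test function. Near
the origin the boundary distance is comparable to \<open>\<rho>(z) = |z\<^sub>2| - |z\<^sub>1|\<^sup>k\<close>
(\<open>hartogs_boundary_distance\<close>), so both bounds have to be of the size \<open>\<rho>\<^sup>-\<^sup>2\<close>.

That the kernel exists at all is a least-norm argument. Among the functions with value 1 at \<open>z\<close>, a
norm-minimizing sequence is Cauchy by the parallelogram law; since point evaluations are locally
bounded it converges locally uniformly, its limit is the minimizer, and the conjugate of the
minimizer, suitably scaled, reproduces the value at \<open>z\<close>. Evaluations are locally bounded because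
\<open>|f|\<^sup>2\<close> satisfies the submean inequality on polydiscs.

For the upper bound, a plain polydisc around \<open>z\<close> is too small: at \<open>z\<^sub>1 = 0\<close> it only yields the exponent
\<open>-2-2/k\<close>. The gain comes from the action \<open>t \<cdot> z = (t z\<^sub>1, t\<^sup>k z\<^sub>2)\<close>, which preserves the inequality
\<open>|z\<^sub>1|\<^sup>k < |z\<^sub>2|\<close>. Along an orbit, \<open>t\<^sup>k f (t \<cdot> z)\<close> is holomorphic in the punctured disc, and
square-integrability of \<open>f\<close> rules out a pole at \<open>t = 0\<close> (\<open>hartogs_orbit_no_pole\<close>). The maximum
principle therefore bounds \<open>f z\<close> by the values of \<open>f\<close> on \<open>|z\<^sub>2| = 1/2\<close>, far from the singular corner.
There the boundary is smooth, but a polydisc with sides parallel to the axes would still lose powers of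
the distance; a polydisc slanted along a branch of \<open>w\<^bsup>1/k\<^esup>\<close> follows the boundary at an essentially
constant distance and gives the sharp exponent (\<open>slanted_polydisc_submean\<close>, \<open>hartogs_shell_estimate\<close>).

For the lower bound, \<open>z\<^sub>1\<^sup>k / z\<^sub>2\<close> maps the domain to the unit disc. The test function is a multiple of
\<open>1/z\<^sub>2\<close> times the Bergman kernel function \<open>(1 - a \<zeta>)\<^sup>-\<^sup>2\<close> of the disc at \<open>\<zeta> = z\<^sub>1\<^sup>k / z\<^sub>2\<close>. Its norm
is estimated on each slice with \<open>z\<^sub>2\<close> fixed, from the Poisson integral on circles and a radial integral.
\<close>

section \<open>Lebesgue measure in coordinates\<close>

lemma vector_2_measurable [measurable]:
  "(\<lambda>(x, y). vector [x, y] :: complex ^ 2) \<in> borel_measurable (lborel \<Otimes>\<^sub>M lborel)"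
proof -
  have "continuous_on UNIV (\<lambda>p::complex \<times> complex. (\<chi> i. if i = 1 then fst p else snd p) :: complex ^ 2)"
  proof (rule continuous_on_vec_lambda)
    show "continuous_on UNIV (\<lambda>p::complex \<times> complex. if i = 1 then fst p else snd p)" for i :: 2
      by (cases "i = 1") (auto intro!: continuous_intros)
  qed
  moreover have "(\<lambda>(x, y). vector [x, y] :: complex ^ 2) = (\<lambda>p. (\<chi> i. if i = 1 then fst p else snd p))"
    by (auto simp: fun_eq_iff vec_eq_iff forall_2)
  ultimately show ?thesis
    unfolding lborel_prod by (simp add: borel_measurable_continuous_onI)
qed

text \<open>
  Both measures give a box the product of its side lengths, and these values determine Lebesgue measure.
\<close>

lemma lborel_complex_vec2:
  "(lborel :: (complex ^ 2) measure)
     = distr (lborel \<Otimes>\<^sub>M lborel) borel (\<lambda>(x, y). vector [x, y])"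
proof (rule lborel_eqI)
  fix l u :: "complex ^ 2"
  assume le: "\<And>b. b \<in> Basis \<Longrightarrow> l \<bullet> b \<le> u \<bullet> b"
  have le': "l $ i \<bullet> b \<le> u $ i \<bullet> b" if "b \<in> Basis" for i b
    using le[of "axis i b"] that by (auto simp: Basis_vec_def inner_axis)
  have mem: "v \<in> box l u \<longleftrightarrow> (\<forall>i. v $ i \<in> box (l $ i) (u $ i))" for v :: "complex ^ 2"
    by (auto simp: mem_box Basis_vec_def inner_axis)
  have "(\<lambda>(x, y). vector [x, y]) -` box l u \<inter> space (lborel \<Otimes>\<^sub>M lborel)
      = box (l $ 1) (u $ 1) \<times> box (l $ 2) (u $ 2)"
    by (auto simp: mem forall_2 space_pair_measure)
  then have "emeasure (distr (lborel \<Otimes>\<^sub>M lborel) borel (\<lambda>(x, y). vector [x, y])) (box l u)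
      = emeasure lborel (box (l $ 1) (u $ 1)) * emeasure lborel (box (l $ 2) (u $ 2))"
    by (simp add: emeasure_distr lborel.emeasure_pair_measure_Times)
  also have "\<dots> = ennreal ((\<Prod>b\<in>Basis. (u $ 1 - l $ 1) \<bullet> b) * (\<Prod>b\<in>Basis. (u $ 2 - l $ 2) \<bullet> b))"
    using le' by (simp add: emeasure_lborel_box ennreal_mult prod_nonneg inner_diff_left)
  also have "(\<Prod>b\<in>Basis. (u $ 1 - l $ 1) \<bullet> b) * (\<Prod>b\<in>Basis. (u $ 2 - l $ 2) \<bullet> b)
      = (\<Prod>b\<in>Basis. (u - l) \<bullet> b)"
  proof -
    have B: "(Basis :: (complex^2) set) = axis 1 ` Basis \<union> axis 2 ` Basis"
      by (auto simp: Basis_vec_def UNIV_2)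
    have inj: "inj_on (axis i) (Basis :: complex set)" for i :: 2
      by (auto simp: inj_on_def axis_eq_axis)
    have disj: "axis 1 ` (Basis :: complex set) \<inter> axis (2::2) ` Basis = {}"
      by (auto simp: axis_eq_axis)
    show ?thesis
      unfolding B
      by (subst prod.union_disjoint[OF _ _ disj])
         (auto simp: prod.reindex[OF inj] inner_axis inner_diff_left)
  qed
  finally show "emeasure (distr (lborel \<Otimes>\<^sub>M lborel) borel (\<lambda>(x, y). vector [x, y])) (box l u)
      = (\<Prod>b\<in>Basis. (u - l) \<bullet> b)" .
qed simp

lemma nn_integral_complex_vec2:
  fixes h :: "complex ^ 2 \<Rightarrow> ennreal"
  assumes [measurable]: "h \<in> borel_measurable borel"
  shows "(\<integral>\<^sup>+v. h v \<partial>lborel) = (\<integral>\<^sup>+w. \<integral>\<^sup>+x. h (vector [x, w]) \<partial>lborel \<partial>lborel)"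
proof -
  have "(\<integral>\<^sup>+v. h v \<partial>lborel) = (\<integral>\<^sup>+p. h ((\<lambda>(x, y). vector [x, y]) p) \<partial>(lborel \<Otimes>\<^sub>M lborel))"
    by (subst lborel_complex_vec2) (simp add: nn_integral_distr)
  also have "\<dots> = (\<integral>\<^sup>+w. \<integral>\<^sup>+x. h (vector [x, w]) \<partial>lborel \<partial>lborel)"
    by (subst lborel_pair.nn_integral_snd[symmetric]) (auto simp: case_prod_beta')
  finally show ?thesis .
qed

lemma lborel_complex:
  "(lborel :: complex measure) = distr (lborel \<Otimes>\<^sub>M lborel) borel (\<lambda>(x, y). Complex x y)"
proof (rule lborel_eqI)
  have meas: "(\<lambda>(x, y). Complex x y) \<in> borel_measurable (lborel \<Otimes>\<^sub>M lborel)"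
    unfolding Complex_eq by measurable
  fix l u :: complex
  assume le: "\<And>b. b \<in> Basis \<Longrightarrow> l \<bullet> b \<le> u \<bullet> b"
  have "Re l \<le> Re u" "Im l \<le> Im u"
    using le[of 1] le[of \<i>] by (auto simp: Basis_complex_def)
  moreover have "(\<lambda>(x, y). Complex x y) -` box l u \<inter> space (lborel \<Otimes>\<^sub>M lborel)
      = {Re l<..<Re u} \<times> {Im l<..<Im u}"
    by (auto simp: in_box_complex_iff space_pair_measure)
  ultimately show "emeasure (distr (lborel \<Otimes>\<^sub>M lborel) borel (\<lambda>(x, y). Complex x y)) (box l u)
      = (\<Prod>b\<in>Basis. (u - l) \<bullet> b)"
    using meas by (simp add: emeasure_distr lborel.emeasure_pair_measure_Times Basis_complex_def ennreal_mult)
qed simp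

lemma nn_integral_complex:
  fixes h :: "complex \<Rightarrow> ennreal"
  assumes [measurable]: "h \<in> borel_measurable borel"
  shows "(\<integral>\<^sup>+z. h z \<partial>lborel) = (\<integral>\<^sup>+y. \<integral>\<^sup>+x. h (Complex x y) \<partial>lborel \<partial>lborel)"
    and "(\<integral>\<^sup>+z. h z \<partial>lborel) = (\<integral>\<^sup>+x. \<integral>\<^sup>+y. h (Complex x y) \<partial>lborel \<partial>lborel)"
proof -
  have [measurable]: "(\<lambda>(x, y). Complex x y) \<in> borel_measurable (lborel \<Otimes>\<^sub>M lborel)"
    unfolding Complex_eq by measurable
  have *: "(\<integral>\<^sup>+z. h z \<partial>lborel) = (\<integral>\<^sup>+p. h ((\<lambda>(x, y). Complex x y) p) \<partial>(lborel \<Otimes>\<^sub>M lborel))"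
    by (subst lborel_complex) (simp add: nn_integral_distr)
  show "(\<integral>\<^sup>+z. h z \<partial>lborel) = (\<integral>\<^sup>+y. \<integral>\<^sup>+x. h (Complex x y) \<partial>lborel \<partial>lborel)"
    unfolding * by (subst lborel_pair.nn_integral_snd[symmetric]) (auto simp: case_prod_beta')
  show "(\<integral>\<^sup>+z. h z \<partial>lborel) = (\<integral>\<^sup>+x. \<integral>\<^sup>+y. h (Complex x y) \<partial>lborel \<partial>lborel)"
    unfolding * by (subst lborel.nn_integral_fst[symmetric]) (auto simp: case_prod_beta')
qed

lemma nn_integral_lborel_shift:
  fixes h :: "real \<Rightarrow> ennreal"
  assumes "h \<in> borel_measurable borel"
  shows "(\<integral>\<^sup>+x. h (x + t) \<partial>lborel) = (\<integral>\<^sup>+x. h x \<partial>lborel)"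
  using nn_integral_real_affine[OF assms, of 1 t] by (simp add: add.commute)

text \<open>
  A shear translates each horizontal (or vertical) line by a constant, so the claim is Fubini's theorem
  together with translation invariance on the line.
\<close>

lemma nn_integral_complex_shear:
  fixes h :: "complex \<Rightarrow> ennreal" and a :: real
  assumes [measurable]: "h \<in> borel_measurable borel"
  shows "(\<integral>\<^sup>+z. h (Complex (Re z + a * Im z) (Im z)) \<partial>lborel) = (\<integral>\<^sup>+z. h z \<partial>lborel)"
    and "(\<integral>\<^sup>+z. h (Complex (Re z) (Im z + a * Re z)) \<partial>lborel) = (\<integral>\<^sup>+z. h z \<partial>lborel)"
proof -
  have [measurable]: "(\<lambda>z. h (Complex (Re z + a * Im z) (Im z))) \<in> borel_measurable borel"
      "(\<lambda>z. h (Complex (Re z) (Im z + a * Re z))) \<in> borel_measurable borel"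
      "(\<lambda>x. h (Complex x y)) \<in> borel_measurable borel"
      "(\<lambda>y. h (Complex x y)) \<in> borel_measurable borel" for x y
    unfolding Complex_eq by measurable
  show "(\<integral>\<^sup>+z. h (Complex (Re z + a * Im z) (Im z)) \<partial>lborel) = (\<integral>\<^sup>+z. h z \<partial>lborel)"
    using nn_integral_lborel_shift[where h = "\<lambda>x. h (Complex x y)" for y]
    by (simp add: nn_integral_complex(1))
  show "(\<integral>\<^sup>+z. h (Complex (Re z) (Im z + a * Re z)) \<partial>lborel) = (\<integral>\<^sup>+z. h z \<partial>lborel)"
    using nn_integral_lborel_shift[where h = "\<lambda>y. h (Complex x y)" for x]
    by (simp add: nn_integral_complex(2))
qed

section \<open>Rotations of the plane and the submean inequality\<close>

text \<open>
  A rotation by any angle other than \<open>\<pi>\<close> is a horizontal, a vertical and again a horizontal shear;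
  the half turn is the square of a quarter turn.
\<close>

lemma nn_integral_complex_rotate:
  fixes h :: "complex \<Rightarrow> ennreal"
  assumes h: "h \<in> borel_measurable borel" and c: "norm c = 1"
  shows "(\<integral>\<^sup>+z. h (c * z) \<partial>lborel) = (\<integral>\<^sup>+z. h z \<partial>lborel)"
proof -
  have main: "(\<integral>\<^sup>+z. k (c * z) \<partial>lborel) = (\<integral>\<^sup>+z. k z \<partial>lborel)"
    if k: "k \<in> borel_measurable borel" and "norm c = 1" "Re c \<noteq> -1" for k :: "complex \<Rightarrow> ennreal" and c
  proof -
    \<comment> \<open>For \<open>c = cis \<theta>\<close> this is \<open>- tan (\<theta>/2)\<close>, the slope of the two outer shears.\<close>
    define a where "a = - Im c / (1 + Re c)"
    define S where "S z = Complex (Re z + a * Im z) (Im z)" for z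
    define T where "T z = Complex (Re z) (Im z + Im c * Re z)" for z
    have ne: "1 + Re c \<noteq> 0" using that by auto
    have sq: "Im c * Im c = (1 - Re c) * (1 + Re c)"
      using \<open>norm c = 1\<close> by (simp add: norm_eq_square power2_eq_square algebra_simps cmod_def)
    have ab: "1 + a * Im c = Re c"
      using ne sq unfolding a_def by (simp add: field_simps)
    have a2: "a * (1 + Re c) = - Im c"
      using ne unfolding a_def by simp
    have dec: "c * z = S (T (S z))" for z
    proof -
      have "Re (S (T (S z))) = Re z * (1 + a * Im c) + Im z * (a * (1 + (1 + a * Im c)))"
        by (simp add: S_def T_def algebra_simps)
      moreover have "Im (S (T (S z))) = Im z * (1 + a * Im c) + Im c * Re z"
        by (simp add: S_def T_def algebra_simps)
      ultimately show ?thesis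
        unfolding ab a2 by (simp add: complex_eq_iff algebra_simps)
    qed
    have [measurable]: "S \<in> borel_measurable borel" "T \<in> borel_measurable borel"
      unfolding S_def T_def Complex_eq by measurable
    note [measurable] = k
    have "(\<integral>\<^sup>+z. k (S (T (S z))) \<partial>lborel) = (\<integral>\<^sup>+z. k (S (T z)) \<partial>lborel)"
      using nn_integral_complex_shear(1)[of "\<lambda>z. k (S (T z))" a] by (simp add: S_def[symmetric])
    also have "\<dots> = (\<integral>\<^sup>+z. k (S z) \<partial>lborel)"
      using nn_integral_complex_shear(2)[of "\<lambda>z. k (S z)" "Im c"] by (simp add: T_def[symmetric])
    also have "\<dots> = (\<integral>\<^sup>+z. k z \<partial>lborel)"
      using nn_integral_complex_shear(1)[of k a] k by (simp add: S_def[symmetric])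
    finally show ?thesis by (simp add: dec)
  qed
  show ?thesis
  proof (cases "Re c = -1")
    case True
    then have "c = -1"
      using c by (auto simp: complex_eq_iff cmod_def real_sqrt_eq_1_iff)
    then have "(\<integral>\<^sup>+z. h (c * z) \<partial>lborel) = (\<integral>\<^sup>+z. h (\<i> * (\<i> * z)) \<partial>lborel)"
      by (simp flip: mult.assoc)
    also have "\<dots> = (\<integral>\<^sup>+z. h (\<i> * z) \<partial>lborel)"
      using h by (subst main[of "\<lambda>z. h (\<i> * z)" \<i>]) auto
    also have "\<dots> = (\<integral>\<^sup>+z. h z \<partial>lborel)"
      using h by (subst main) auto
    finally show ?thesis .
  qed (use main h c in auto)
qed

lemma nn_integral_lborel_translate:
  fixes h :: "'a::euclidean_space \<Rightarrow> ennreal"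
  assumes [measurable]: "h \<in> borel_measurable borel"
  shows "(\<integral>\<^sup>+x. h (p + x) \<partial>lborel) = (\<integral>\<^sup>+x. h x \<partial>lborel)"
  by (subst lborel_affine[of 1 p, simplified])
     (simp_all add: nn_integral_density nn_integral_distr one_ennreal_def[symmetric])

text \<open>
  Rotation invariance, averaged over all angles. It takes the place of polar coordinates throughout.
\<close>

lemma nn_integral_circle_average:
  fixes h :: "complex \<Rightarrow> ennreal"
  assumes [measurable]: "h \<in> borel_measurable borel"
  shows "(\<integral>\<^sup>+z. (\<integral>\<^sup>+t\<in>{0..2*pi}. h (cis t * z) \<partial>lborel) \<partial>lborel) = ennreal (2 * pi) * (\<integral>\<^sup>+z. h z \<partial>lborel)"
proof -
  have [measurable]: "cis \<in> borel_measurable borel"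
    by (intro borel_measurable_continuous_onI continuous_intros)
  have "(\<integral>\<^sup>+z. (\<integral>\<^sup>+t\<in>{0..2*pi}. h (cis t * z) \<partial>lborel) \<partial>lborel)
      = (\<integral>\<^sup>+t. (\<integral>\<^sup>+z. h (cis t * z) * indicator {0..2*pi} t \<partial>lborel) \<partial>lborel)"
    by (rule lborel_pair.Fubini') simp
  also have "\<dots> = (\<integral>\<^sup>+t. (\<integral>\<^sup>+z. h z \<partial>lborel) * indicator {0..2*pi} t \<partial>lborel)"
    by (intro nn_integral_cong) (simp add: nn_integral_multc nn_integral_complex_rotate)
  also have "\<dots> = ennreal (2 * pi) * (\<integral>\<^sup>+z. h z \<partial>lborel)"
    by (simp add: nn_integral_cmult mult.commute)
  finally show ?thesis .
qed

text \<open>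
  Cauchy's formula for the function \<open>\<zeta> \<mapsto> f (p + \<zeta> w)\<close> on the unit circle.
\<close>

lemma holomorphic_circle_mean:
  assumes f: "f holomorphic_on ball p R" and w: "norm w < R"
  shows "((\<lambda>t. f (p + cis t * w)) has_integral (2 * of_real pi * f p)) {0..2*pi}"
proof (cases "w = 0")
  case True
  then show ?thesis
    using has_integral_const_real[of "f p" 0 "2 * pi"] by (simp add: scaleR_conv_of_real)
next
  case False
  define F where "F \<zeta> = f (p + \<zeta> * w)" for \<zeta>
  have "F holomorphic_on cball 0 1"
    unfolding F_def
  proof (intro holomorphic_on_compose_gen[OF _ f, unfolded o_def] holomorphic_intros, safe)
    fix \<zeta> :: complex assume "\<zeta> \<in> cball 0 1"
    then have "norm (\<zeta> * w) \<le> norm w" by (auto simp: norm_mult mult_left_le_one_le)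
    then show "p + \<zeta> * w \<in> ball p R" using w by (simp add: dist_norm)
  qed
  then have "((\<lambda>u. F u / (u - 0)) has_contour_integral (2 * of_real pi * \<i> * F 0)) (circlepath 0 1)"
    by (rule Cauchy_integral_circlepath_simple) simp
  then have "((\<lambda>t. F (cis t) / cis t * \<i> * cis t) has_integral (2 * of_real pi * \<i> * F 0)) {0..2*pi}"
    by (simp add: circlepath_def has_contour_integral_part_circlepath_iff)
  from has_integral_mult_right[OF this, of "-\<i>"] show ?thesis
    by (simp add: F_def mult_ac)
qed

lemma holomorphic_circle_submean:
  assumes f: "f holomorphic_on ball p R" and w: "norm w < R"
  shows "ennreal (2 * pi) * ennreal (norm (f p)) \<le> (\<integral>\<^sup>+t\<in>{0..2*pi}. ennreal (norm (f (p + cis t * w))) \<partial>lborel)"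
proof -
  note mean = holomorphic_circle_mean[OF assms]
  have cont: "continuous_on {0..2*pi} (\<lambda>t. f (p + cis t * w))"
    by (rule continuous_on_compose2[OF holomorphic_on_imp_continuous_on[OF f]])
       (use w in \<open>auto intro!: continuous_intros simp: dist_norm norm_mult\<close>)
  define I where "I = integral {0..2*pi} (\<lambda>t. norm (f (p + cis t * w)))"
  have I: "((\<lambda>t. norm (f (p + cis t * w))) has_integral I) {0..2*pi}"
    unfolding I_def by (intro integrable_integral integrable_continuous_real continuous_intros cont)
  have "norm (2 * of_real pi * f p) \<le> I"
    using mean I by (metis has_integral_iff I_def integral_norm_bound_integral order_refl)
  then have "2 * pi * norm (f p) \<le> I"
    by (simp add: norm_mult)
  moreover have "(\<integral>\<^sup>+t\<in>{0..2*pi}. ennreal (norm (f (p + cis t * w))) \<partial>lborel) = ennreal I"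
  proof -
    have "(\<integral>\<^sup>+t\<in>{0..2*pi}. ennreal (norm (f (p + cis t * w))) \<partial>lborel)
        = (\<integral>\<^sup>+t. ennreal (indicator {0..2*pi} t * norm (f (p + cis t * w))) \<partial>lborel)"
      by (intro nn_integral_cong) (simp split: split_indicator)
    then show ?thesis
      using nn_integral_has_integral_lebesgue[OF _ I] by simp
  qed
  ultimately show ?thesis
    by (simp add: ennreal_leI flip: ennreal_mult)
qed

text \<open>
  The circle inequality for \<open>f\<^sup>2\<close>, integrated over the disc: by rotation invariance the average over
  circles of the right-hand side is the integral itself.
\<close>

lemma holomorphic_disc_submean:
  assumes f: "f holomorphic_on ball p r"
  shows "ennreal ((norm (f p))\<^sup>2) * emeasure lborel (ball p r)
      \<le> (\<integral>\<^sup>+w\<in>ball p r. ennreal ((norm (f w))\<^sup>2) \<partial>lborel)"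
proof -
  define h where "h w = ennreal ((norm (f (p + w)))\<^sup>2) * indicator (ball 0 r) w" for w
  have cont: "continuous_on (ball 0 r) (\<lambda>w. (norm (f (p + w)))\<^sup>2)"
    by (intro continuous_intros continuous_on_compose2[OF holomorphic_on_imp_continuous_on[OF f]])
       (auto simp: dist_norm)
  have h [measurable]: "h \<in> borel_measurable borel"
  proof -
    have "(\<lambda>w. ennreal (indicator (ball 0 r) w *\<^sub>R (norm (f (p + w)))\<^sup>2)) \<in> borel_measurable borel"
      by (intro measurable_compose[OF borel_measurable_continuous_on_indicator[OF _ cont]]) auto
    also have "(\<lambda>w. ennreal (indicator (ball 0 r) w *\<^sub>R (norm (f (p + w)))\<^sup>2)) = h"
      by (auto simp: h_def fun_eq_iff split: split_indicator)
    finally show ?thesis .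
  qed
  have f2: "(\<lambda>w. (f w)\<^sup>2) holomorphic_on ball p r"
    by (intro holomorphic_intros f)
  have pointwise: "ennreal (2 * pi) * (ennreal ((norm (f p))\<^sup>2) * indicator (ball 0 r) w)
      \<le> (\<integral>\<^sup>+t\<in>{0..2*pi}. h (cis t * w) \<partial>lborel)" for w
  proof (cases "w \<in> ball 0 r")
    case True
    have "h (cis t * w) = ennreal (norm ((f (p + cis t * w))\<^sup>2))" for t
      using True by (simp add: h_def norm_mult norm_power)
    then show ?thesis
      using True holomorphic_circle_submean[OF f2, of w] by (simp add: norm_power)
  qed simp
  have "(\<integral>\<^sup>+w. ennreal (2 * pi) * (ennreal ((norm (f p))\<^sup>2) * indicator (ball (0::complex) r) w) \<partial>lborel)
      \<le> (\<integral>\<^sup>+w. (\<integral>\<^sup>+t\<in>{0..2*pi}. h (cis t * w) \<partial>lborel) \<partial>lborel)"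
    by (rule nn_integral_mono) (rule pointwise)
  also have "\<dots> = ennreal (2 * pi) * (\<integral>\<^sup>+w. h w \<partial>lborel)"
    by (rule nn_integral_circle_average) fact
  also have "(\<integral>\<^sup>+w. ennreal (2 * pi) * (ennreal ((norm (f p))\<^sup>2) * indicator (ball (0::complex) r) w) \<partial>lborel)
     = ennreal (2 * pi) * (ennreal ((norm (f p))\<^sup>2) * emeasure lborel (ball (0::complex) r))"
    by (simp add: nn_integral_cmult_indicator mult.assoc[symmetric])
  finally have "ennreal ((norm (f p))\<^sup>2) * emeasure lborel (ball (0::complex) r) \<le> (\<integral>\<^sup>+w. h w \<partial>lborel)"
    by (subst (asm) ennreal_mult_le_mult_iff) auto
  also have "(\<integral>\<^sup>+w. h w \<partial>lborel) = (\<integral>\<^sup>+w. h (- p + w) \<partial>lborel)"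
    by (rule nn_integral_lborel_translate[symmetric]) fact
  also have "\<dots> = (\<integral>\<^sup>+w\<in>ball p r. ennreal ((norm (f w))\<^sup>2) \<partial>lborel)"
    by (intro nn_integral_cong) (auto simp: h_def dist_norm norm_minus_commute split: split_indicator)
  also have "emeasure lborel (ball (0::complex) r) = emeasure lborel (ball p r)"
    by (cases "r \<ge> 0") (simp_all add: emeasure_ball ball_empty)
  finally show ?thesis .
qed

text \<open>
  A disc of radius \<open>r\<close> has area \<open>\<pi> r\<^sup>2\<close>, so the map \<open>z \<mapsto> |z|\<^sup>2\<close> carries planar measure to \<open>\<pi>\<close> times
  length on the half-line.
\<close>

lemma nn_integral_complex_radial:
  fixes h :: "real \<Rightarrow> ennreal"
  assumes [measurable]: "h \<in> borel_measurable borel"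
  shows "(\<integral>\<^sup>+z. h ((norm (z::complex))\<^sup>2) \<partial>lborel) = ennreal pi * (\<integral>\<^sup>+x\<in>{0..}. h x \<partial>lborel)"
proof -
  define M where "M = distr (lborel :: complex measure) borel (\<lambda>z. (norm z)\<^sup>2)"
  define N where "N = density lborel (\<lambda>x::real. ennreal pi * indicator {0..} x)"
  have M: "emeasure M {..<x} = ennreal (pi * max 0 x)" for x
  proof -
    have "(\<lambda>z::complex. (norm z)\<^sup>2) -` {..<x} = ball 0 (sqrt (max 0 x))"
    proof (cases "x \<ge> 0")
      case True
      then show ?thesis
        by (auto simp: real_less_rsqrt dest: real_less_lsqrt)
           (metis norm_ge_zero real_sqrt_less_iff real_sqrt_unique real_sqrt_pow2 power2_less_imp_less real_less_rsqrt sqrt_le_D linorder_not_less)+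
    next
      case False
      then have "\<not> (norm z)\<^sup>2 < x" for z :: complex
        by (meson less_le_trans not_le zero_le_power2 order.strict_trans linorder_not_less)
      then show ?thesis using False by auto
    qed
    then show ?thesis
      by (simp add: M_def emeasure_distr emeasure_ball unit_ball_vol_2)
  qed
  have N: "emeasure N {..<x} = ennreal (pi * max 0 x)" for x
  proof -
    have "emeasure N {..<x} = (\<integral>\<^sup>+y. ennreal pi * indicator {0..<x} y \<partial>lborel)"
      unfolding N_def by (subst emeasure_density)
        (auto intro!: nn_integral_cong simp: split: split_indicator)
    also have "\<dots> = ennreal (pi * max 0 x)"
      by (cases "x \<ge> 0") (auto simp: nn_integral_cmult ennreal_mult)
    finally show ?thesis .
  qed
  have "M = N"
  proof (rule measure_eqI_generator_eq)
    let ?E = "range (lessThan :: real \<Rightarrow> real set)"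
    show "Int_stable ?E"
    proof (unfold Int_stable_def, clarify)
      fix a b :: real
      have "{..<a} \<inter> {..<b} = {..<min a b}" by auto
      then show "{..<a} \<inter> {..<b} \<in> ?E" by blast
    qed
    show "?E \<subseteq> Pow UNIV" by simp
    show "sets M = sigma_sets UNIV ?E" "sets N = sigma_sets UNIV ?E"
      unfolding M_def N_def by (simp_all add: borel_Iio) 
    show "range (\<lambda>n::nat. {..<real n}) \<subseteq> ?E" by auto
    show "(\<Union>n::nat. {..<real n}) = UNIV"
      by (auto intro: reals_Archimedean2)
    show "emeasure M {..<real n} \<noteq> \<infinity>" for n by (simp add: M)
    show "emeasure M X = emeasure N X" if "X \<in> ?E" for X
      using that by (auto simp: M N)
  qed
  then have "(\<integral>\<^sup>+x. h x \<partial>M) = (\<integral>\<^sup>+x. h x \<partial>N)" by simp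
  then show ?thesis
    unfolding M_def N_def
    by (simp add: nn_integral_distr nn_integral_density nn_integral_cmult mult_ac)
qed

section \<open>Holomorphic functions of several variables\<close>

lemma holomorphic_several_continuous_on:
  "holomorphic_several \<Omega> f \<Longrightarrow> continuous_on \<Omega> f"
  unfolding holomorphic_several_def
  by (meson continuous_at_imp_continuous_on has_derivative_continuous)

lemma holomorphic_several_subset:
  "holomorphic_several \<Omega> f \<Longrightarrow> \<Omega>' \<subseteq> \<Omega> \<Longrightarrow> holomorphic_several \<Omega>' f"
  unfolding holomorphic_several_def by blast

lemma holomorphic_several_cong:
  assumes "open \<Omega>" "holomorphic_several \<Omega> f" "\<And>z. z \<in> \<Omega> \<Longrightarrow> f z = g z"
  shows "holomorphic_several \<Omega> g"
  unfolding holomorphic_several_def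
  by (metis (mono_tags, lifting) assms has_derivative_transform_within_open holomorphic_several_def)

lemma holomorphic_several_const: "holomorphic_several \<Omega> (\<lambda>_. c)"
  unfolding holomorphic_several_def by (auto intro!: exI[of _ "\<lambda>_. 0"])

lemma holomorphic_several_nth: "holomorphic_several \<Omega> (\<lambda>z. z $ i)"
  unfolding holomorphic_several_def
  by (auto intro!: exI[of _ "\<lambda>v. v $ i"] bounded_linear_imp_has_derivative bounded_linear_vec_nth)

lemma holomorphic_several_add:
  assumes "holomorphic_several \<Omega> f" "holomorphic_several \<Omega> g"
  shows "holomorphic_several \<Omega> (\<lambda>z. f z + g z)"
  unfolding holomorphic_several_def
proof
  fix z assume "z \<in> \<Omega>"
  then obtain f' g' where "(f has_derivative f') (at z)" "\<And>c v. f' (c *s v) = c * f' v"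
      "(g has_derivative g') (at z)" "\<And>c v. g' (c *s v) = c * g' v"
    using assms unfolding holomorphic_several_def by metis
  then show "\<exists>h'. ((\<lambda>z. f z + g z) has_derivative h') (at z) \<and> (\<forall>c v. h' (c *s v) = c * h' v)"
    by (intro exI[of _ "\<lambda>v. f' v + g' v"] conjI has_derivative_add) (auto simp: algebra_simps)
qed

lemma holomorphic_several_mult:
  assumes "holomorphic_several \<Omega> f" "holomorphic_several \<Omega> g"
  shows "holomorphic_several \<Omega> (\<lambda>z. f z * g z)"
  unfolding holomorphic_several_def
proof
  fix z assume "z \<in> \<Omega>"
  then obtain f' g' where "(f has_derivative f') (at z)" "\<And>c v. f' (c *s v) = c * f' v"
      "(g has_derivative g') (at z)" "\<And>c v. g' (c *s v) = c * g' v"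
    using assms unfolding holomorphic_several_def by metis
  then show "\<exists>h'. ((\<lambda>z. f z * g z) has_derivative h') (at z) \<and> (\<forall>c v. h' (c *s v) = c * h' v)"
    by (intro exI[of _ "\<lambda>v. f z * g' v + f' v * g z"] conjI has_derivative_mult) (auto simp: algebra_simps)
qed

lemma holomorphic_several_power:
  "holomorphic_several \<Omega> f \<Longrightarrow> holomorphic_several \<Omega> (\<lambda>z. f z ^ n)"
  by (induction n) (auto intro: holomorphic_several_const holomorphic_several_mult)

lemma holomorphic_several_diff:
  assumes "holomorphic_several \<Omega> f" "holomorphic_several \<Omega> g"
  shows "holomorphic_several \<Omega> (\<lambda>z. f z - g z)"
  using holomorphic_several_add[OF assms(1) holomorphic_several_mult[OF holomorphic_several_const[of _ "-1"] assms(2)]]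
  by simp

lemma holomorphic_several_inverse:
  assumes "holomorphic_several \<Omega> f" "\<And>z. z \<in> \<Omega> \<Longrightarrow> f z \<noteq> 0"
  shows "holomorphic_several \<Omega> (\<lambda>z. inverse (f z))"
  unfolding holomorphic_several_def
proof
  fix z assume z: "z \<in> \<Omega>"
  then obtain f' where f': "(f has_derivative f') (at z)" "\<And>c v. f' (c *s v) = c * f' v"
    using assms unfolding holomorphic_several_def by metis
  have "((\<lambda>z. inverse (f z)) has_derivative (\<lambda>v. - (inverse (f z) * f' v * inverse (f z)))) (at z)"
    by (rule Deriv.has_derivative_inverse) (use f' assms(2)[OF z] in auto)
  then show "\<exists>h'. ((\<lambda>z. inverse (f z)) has_derivative h') (at z) \<and> (\<forall>c v. h' (c *s v) = c * h' v)"
    by (intro exI conjI) (auto simp: f'(2))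
qed

text \<open>
  The chain rule; complex linearity of the derivative of \<open>f\<close> makes the composite complex differentiable.
  It reduces questions about several variables to one-variable theory along lines and curves.
\<close>

lemma holomorphic_several_curve:
  fixes f :: "complex ^ 'n \<Rightarrow> complex"
  assumes f: "holomorphic_several \<Omega> f"
    and \<gamma>: "\<And>i. (\<lambda>w. \<gamma> w $ i) holomorphic_on S" and "open S" and sub: "\<And>w. w \<in> S \<Longrightarrow> \<gamma> w \<in> \<Omega>"
  shows "(\<lambda>w. f (\<gamma> w)) holomorphic_on S"
  unfolding holomorphic_on_open[OF \<open>open S\<close>]
proof
  fix w assume w: "w \<in> S"
  have "\<exists>d. ((\<lambda>w. \<gamma> w $ i) has_field_derivative d) (at w)" for i
    using \<gamma>[of i] w by (simp add: holomorphic_on_open[OF \<open>open S\<close>])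
  then obtain d where d: "\<And>i. ((\<lambda>w. \<gamma> w $ i) has_field_derivative d i) (at w)"
    by metis
  define D :: "complex ^ 'n" where "D = (\<chi> i. d i)"
  have \<gamma>': "(\<gamma> has_derivative (\<lambda>t. t *s D)) (at w)"
    unfolding has_derivative_componentwise_within[of \<gamma>] 
  proof
    fix b :: "complex ^ 'n" assume "b \<in> Basis"
    then obtain i u where b: "b = axis i u" by (auto simp: Basis_vec_def)
    have "((\<lambda>w. (\<gamma> w $ i) \<bullet> u) has_derivative (\<lambda>t. (d i * t) \<bullet> u)) (at w)"
      using d[of i] unfolding has_field_derivative_def by (rule has_derivative_inner_left)
    then show "((\<lambda>w. \<gamma> w \<bullet> b) has_derivative (\<lambda>t. (t *s D) \<bullet> b)) (at w)"
      by (simp add: b inner_axis D_def mult.commute)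
  qed
  obtain f' where f': "(f has_derivative f') (at (\<gamma> w))" "\<And>c v. f' (c *s v) = c * f' v"
    using f sub[OF w] unfolding holomorphic_several_def by metis
  from has_derivative_compose[OF \<gamma>' f'(1)]
  have "((\<lambda>w. f (\<gamma> w)) has_derivative (\<lambda>t. f' (t *s D))) (at w)" .
  then have "((\<lambda>w. f (\<gamma> w)) has_field_derivative f' D) (at w)"
    by (rule has_derivative_imp_has_field_derivative) (simp add: f'(2))
  then show "\<exists>f'. ((\<lambda>w. f (\<gamma> w)) has_field_derivative f') (at w)" ..
qed

lemma norm_vector_smult: "norm (c *s v) = norm c * norm (v :: complex ^ 'n)"
  by (simp add: norm_vec_def L2_set_def norm_mult power_mult_distrib sum_distrib_left[symmetric] real_sqrt_mult)

text \<open>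
  Cauchy's inequality on the complex line through \<open>x\<close> in the direction \<open>v\<close>.
\<close>

lemma holomorphic_several_derivative_bound:
  fixes f :: "complex ^ 'n \<Rightarrow> complex"
  assumes f: "holomorphic_several (ball x r) f" and bound: "\<And>y. y \<in> ball x r \<Longrightarrow> norm (f y) \<le> B"
    and f': "(f has_derivative f') (at x)" and lin: "\<And>c v. f' (c *s v) = c * f' v" and r: "0 < r"
  shows "norm (f' v) \<le> 2 * B / r * norm v"
proof (cases "v = 0")
  case True
  then show ?thesis using lin[of 0 v] by simp
next
  case False
  \<comment> \<open>Half the largest admissible radius, so that the closed disc of radius \<open>\<rho>\<close> stays in the open ball.\<close>
  define \<rho> where "\<rho> = r / (2 * norm v)"
  have \<rho>: "0 < \<rho>" using False r by (simp add: \<rho>_def)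
  have in_ball: "x + t *s v \<in> ball x r" if "norm t < 2 * \<rho>" for t
    using that False by (simp add: dist_norm norm_vector_smult \<rho>_def field_simps)
  have hol: "(\<lambda>t. f (x + t *s v)) holomorphic_on ball 0 (2 * \<rho>)"
  proof (rule holomorphic_several_curve[OF f])
    show "(\<lambda>t. (x + t *s v) $ i) holomorphic_on ball 0 (2 * \<rho>)" for i
      by (auto intro!: holomorphic_intros)
  qed (use in_ball in auto)
  have "(\<lambda>t. f (x + t *s v)) holomorphic_on cball 0 \<rho>"
    by (rule holomorphic_on_subset[OF hol]) (use \<rho> in auto)
  then have "norm ((deriv ^^ 1) (\<lambda>t. f (x + t *s v)) 0) \<le> fact 1 * B / \<rho> ^ 1"
    by (intro Cauchy_inequality bound in_ball)
       (use \<rho> in \<open>auto intro: holomorphic_on_subset holomorphic_on_imp_continuous_on\<close>)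
  moreover have "((\<lambda>t. f (x + t *s v)) has_derivative (\<lambda>t. f' (t *s v))) (at 0)"
  proof (rule has_derivative_compose[of "\<lambda>t. x + t *s v"])
    have "bounded_linear (\<lambda>t::complex. t *s v)"
      by (rule bounded_linear_intro[of _ "norm v"])
         (auto simp: norm_vector_smult vec_eq_iff algebra_simps)
    then show "((\<lambda>t. x + t *s v) has_derivative (\<lambda>t. t *s v)) (at 0)"
      by (auto intro!: derivative_eq_intros bounded_linear_imp_has_derivative)
    show "(f has_derivative f') (at (x + 0 *s v))" using f' by simp
  qed
  then have "((\<lambda>t. f (x + t *s v)) has_field_derivative f' v) (at 0)"
    by (rule has_derivative_imp_has_field_derivative) (simp add: lin)
  then have "deriv (\<lambda>t. f (x + t *s v)) 0 = f' v" by (rule DERIV_imp_deriv)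
  ultimately show ?thesis
    by (simp add: \<rho>_def mult_ac)
qed

text \<open>
  By Cauchy's inequality the derivatives form a uniform Cauchy sequence on smaller balls, so the theorem
  on differentiating a sequence of functions applies; complex linearity survives the limit.
\<close>

lemma holomorphic_several_uniform_limit:
  fixes F :: "nat \<Rightarrow> complex ^ 'n \<Rightarrow> complex"
  assumes "open \<Omega>" and F: "\<And>n. holomorphic_several \<Omega> (F n)"
    and lim: "\<And>z. z \<in> \<Omega> \<Longrightarrow> \<exists>r>0. uniform_limit (ball z r) F f sequentially"
  shows "holomorphic_several \<Omega> f"
  unfolding holomorphic_several_def
proof
  fix z assume z: "z \<in> \<Omega>"
  obtain r1 r2 where r: "0 < r1" "ball z r1 \<subseteq> \<Omega>" "0 < r2" "uniform_limit (ball z r2) F f sequentially"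
    using z lim \<open>open \<Omega>\<close> by (meson openE)
  define r where "r = min r1 r2 / 2"
  have r0: "r > 0" using r by (simp add: r_def)
  have sub: "ball z (2 * r) \<subseteq> \<Omega>" using r by (auto simp: r_def)
  have ul: "uniform_limit (ball z (2 * r)) F f sequentially"
    by (rule uniform_limit_on_subset[OF r(4)]) (auto simp: r_def)
  obtain F' where F': "\<And>n x. x \<in> \<Omega> \<Longrightarrow> (F n has_derivative F' n x) (at x)"
      "\<And>n x c v. x \<in> \<Omega> \<Longrightarrow> F' n x (c *s v) = c * F' n x v"
    using F unfolding holomorphic_several_def by metis
  have cauchy: "\<exists>N. \<forall>m\<ge>N. \<forall>n\<ge>N. \<forall>x\<in>ball z r. \<forall>v. norm (F' m x v - F' n x v) \<le> e * norm v"
    if e: "e > 0" for e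
  proof -
    have "uniformly_Cauchy_on (ball z (2 * r)) F"
      using ul by (intro uniformly_convergent_Cauchy) (auto simp: uniformly_convergent_on_def)
    then obtain N where N: "\<And>m n y. m \<ge> N \<Longrightarrow> n \<ge> N \<Longrightarrow> y \<in> ball z (2*r) \<Longrightarrow> dist (F m y) (F n y) < e * r / 2"
      using e r0 unfolding uniformly_Cauchy_on_def by (metis divide_pos_pos mult_pos_pos zero_less_numeral)
    have "norm (F' m x v - F' n x v) \<le> e * norm v" if "m \<ge> N" "n \<ge> N" and x: "x \<in> ball z r" for m n x v
    proof -
      have xr: "ball x r \<subseteq> ball z (2 * r)"
        using x by (auto simp: ball_subset_ball_iff dist_commute)
      have x\<Omega>: "x \<in> \<Omega>" using xr sub r0 by (meson centre_in_ball subsetD)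
      have "norm ((\<lambda>v. F' m x v - F' n x v) v) \<le> 2 * (e * r / 2) / r * norm v"
      proof (rule holomorphic_several_derivative_bound[where f = "\<lambda>y. F m y - F n y"])
        show "holomorphic_several (ball x r) (\<lambda>y. F m y - F n y)"
          using xr sub by (intro holomorphic_several_diff holomorphic_several_subset[OF F]) auto
        show "((\<lambda>y. F m y - F n y) has_derivative (\<lambda>v. F' m x v - F' n x v)) (at x)"
          by (intro has_derivative_diff F'(1) x\<Omega>)
        show "norm (F m y - F n y) \<le> e * r / 2" if "y \<in> ball x r" for y
          using N[OF \<open>m \<ge> N\<close> \<open>n \<ge> N\<close>] xr that by (auto simp: dist_norm intro!: less_imp_le)
        show "F' m x (c *s v) - F' n x (c *s v) = c * (F' m x v - F' n x v)" for c v
          by (simp add: F'(2)[OF x\<Omega>] algebra_simps)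
      qed (rule r0)
      then show ?thesis using r0 by simp
    qed
    then show ?thesis by blast
  qed
  define g' where "g' x v = lim (\<lambda>n. F' n x v)" for x v
  have conv: "(\<lambda>n. F' n x v) \<longlonglongrightarrow> g' x v" if "x \<in> ball z r" for x v
  proof -
    have "Cauchy (\<lambda>n. F' n x v)"
    proof (rule metric_CauchyI)
      fix e :: real assume "e > 0"
      then have "e / (norm v + 1) > 0"
        by (simp add: add_nonneg_pos)
      from cauchy[OF this] obtain N where
        N0: "\<forall>m\<ge>N. \<forall>n\<ge>N. \<forall>x\<in>ball z r. \<forall>u. norm (F' m x u - F' n x u) \<le> e / (norm v + 1) * norm u" ..
      then have N: "norm (F' m x v - F' n x v) \<le> e / (norm v + 1) * norm v" if "m \<ge> N" "n \<ge> N" for m n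
        using that \<open>x \<in> ball z r\<close> by simp
      have "e / (norm v + 1) * norm v < e"
        using \<open>e > 0\<close>
        by (subst times_divide_eq_left, subst pos_divide_less_eq) (auto simp: add_nonneg_pos ring_distribs)
      then show "\<exists>N. \<forall>m\<ge>N. \<forall>n\<ge>N. dist (F' m x v) (F' n x v) < e"
        unfolding dist_norm by (intro exI[of _ N] allI impI) (rule le_less_trans[OF N])
    qed
    then show ?thesis
      unfolding g'_def by (rule convergent_LIMSEQ_iff[THEN iffD1, OF Cauchy_convergent])
  qed
  have "\<exists>g. \<forall>x\<in>ball z r. (\<lambda>n. F n x) \<longlonglongrightarrow> g x \<and> (g has_derivative g' x) (at x within ball z r)"
  proof (rule has_derivative_sequence[where f = F and f' = F' and g' = g' and ?x0.0 = z and l = "f z"])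
    show "(F n has_derivative F' n x) (at x within ball z r)" if "x \<in> ball z r" for n x
    proof -
      have "x \<in> ball z (2 * r)" using that r0 by auto
      then show ?thesis using sub by (intro has_derivative_at_withinI[OF F'(1)]) blast
    qed
    show "\<forall>\<^sub>F n in sequentially. \<forall>x\<in>ball z r. \<forall>h. norm (F' n x h - g' x h) \<le> e * norm h" if "e > 0" for e
    proof -
      from cauchy[OF \<open>e > 0\<close>] obtain N where
        N: "\<forall>m\<ge>N. \<forall>n\<ge>N. \<forall>x\<in>ball z r. \<forall>v. norm (F' m x v - F' n x v) \<le> e * norm v" ..
      have "norm (F' n x h - g' x h) \<le> e * norm h" if "n \<ge> N" "x \<in> ball z r" for n x h
      proof (rule tendsto_upperbound)
        show "(\<lambda>m. norm (F' n x h - F' m x h)) \<longlonglongrightarrow> norm (F' n x h - g' x h)"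
          by (intro tendsto_intros conv that)
        show "\<forall>\<^sub>F m in sequentially. norm (F' n x h - F' m x h) \<le> e * norm h"
          using eventually_ge_at_top[of N] by (rule eventually_mono) (use N that in simp)
      qed simp
      then show ?thesis
        by (intro eventually_mono[OF eventually_ge_at_top[of N]] ballI allI)
    qed
    show "(\<lambda>n. F n z) \<longlonglongrightarrow> f z"
      using tendsto_uniform_limitI[OF ul] r0 by simp
  qed (use r0 in auto)
  then obtain g where g: "\<And>x. x \<in> ball z r \<Longrightarrow> (\<lambda>n. F n x) \<longlonglongrightarrow> g x"
      "\<And>x. x \<in> ball z r \<Longrightarrow> (g has_derivative g' x) (at x within ball z r)" by blast
  have gf: "g x = f x" if "x \<in> ball z r" for x
    using that r0 by (intro LIMSEQ_unique[OF g(1)] tendsto_uniform_limitI[OF ul]) auto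
  have zb: "z \<in> ball z r" using r0 by simp
  have "(g has_derivative g' z) (at z)"
    using g(2)[OF zb] at_within_open[OF zb open_ball] by simp
  then have "(f has_derivative g' z) (at z)"
    by (rule has_derivative_transform_within_open[OF _ open_ball zb]) (rule gf)
  moreover have "g' z (c *s v) = c * g' z v" for c v
  proof (rule LIMSEQ_unique[OF conv[OF zb]])
    show "(\<lambda>n. F' n z (c *s v)) \<longlonglongrightarrow> c * g' z v"
      unfolding F'(2)[OF z] by (intro tendsto_intros conv zb)
  qed
  ultimately show "\<exists>f'. (f has_derivative f') (at z) \<and> (\<forall>c v. f' (c *s v) = c * f' v)" by blast
qed

section \<open>Existence and extremal property of the Bergman kernel\<close>

definition bergman_inner :: "(complex ^ 'n) set \<Rightarrow> (complex ^ 'n \<Rightarrow> complex) \<Rightarrow> (complex ^ 'n \<Rightarrow> complex) \<Rightarrow> complex"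
  where "bergman_inner \<Omega> f g = (LINT z:\<Omega>|lborel. f z * cnj (g z))"

definition bergman_norm2 :: "(complex ^ 'n) set \<Rightarrow> (complex ^ 'n \<Rightarrow> complex) \<Rightarrow> real"
  where "bergman_norm2 \<Omega> f = (LINT z:\<Omega>|lborel. (norm (f z))\<^sup>2)"

lemma set_borel_measurable_continuous:
  fixes f :: "'a::euclidean_space \<Rightarrow> 'b::{second_countable_topology, real_normed_vector}"
  assumes "open S" "continuous_on S f"
  shows "set_borel_measurable lborel S f"
  using borel_measurable_continuous_on_indicator[of S f] assms
  by (simp add: set_borel_measurable_def)

lemma bergman_density_measurable:
  fixes f :: "complex ^ 'n \<Rightarrow> complex"
  assumes "open \<Omega>" "holomorphic_several \<Omega> f"
  shows "(\<lambda>z. ennreal ((norm (f z))\<^sup>2) * indicator \<Omega> z) \<in> borel_measurable borel"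
proof -
  have "set_borel_measurable lborel \<Omega> (\<lambda>z. (norm (f z))\<^sup>2)"
    using assms by (intro set_borel_measurable_continuous continuous_intros holomorphic_several_continuous_on)
  then have "(\<lambda>z. ennreal (indicator \<Omega> z *\<^sub>R (norm (f z))\<^sup>2)) \<in> borel_measurable borel"
    unfolding set_borel_measurable_def by simp
  moreover have "(\<lambda>z. ennreal (indicator \<Omega> z *\<^sub>R (norm (f z))\<^sup>2)) = (\<lambda>z. ennreal ((norm (f z))\<^sup>2) * indicator \<Omega> z)"
    by (auto simp: fun_eq_iff split: split_indicator)
  ultimately show ?thesis by (simp only:)
qed

lemma bergman_space_nn_integral:
  fixes f :: "complex ^ 'n \<Rightarrow> complex"
  assumes "open \<Omega>" and f: "holomorphic_several \<Omega> f"
  shows "f \<in> bergman_space \<Omega> \<longleftrightarrow> (\<integral>\<^sup>+z\<in>\<Omega>. ennreal ((norm (f z))\<^sup>2) \<partial>lborel) < \<infinity>"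
    and "f \<in> bergman_space \<Omega> \<Longrightarrow>
      (\<integral>\<^sup>+z\<in>\<Omega>. ennreal ((norm (f z))\<^sup>2) \<partial>lborel) = ennreal (bergman_norm2 \<Omega> f)"
proof -
  have meas: "set_borel_measurable lborel \<Omega> (\<lambda>z. (norm (f z))\<^sup>2)"
    using assms by (intro set_borel_measurable_continuous continuous_intros holomorphic_several_continuous_on)
  have eq: "(\<integral>\<^sup>+z\<in>\<Omega>. ennreal ((norm (f z))\<^sup>2) \<partial>lborel)
      = (\<integral>\<^sup>+z. ennreal (indicator \<Omega> z *\<^sub>R (norm (f z))\<^sup>2) \<partial>lborel)"
    by (intro nn_integral_cong) (auto split: split_indicator)
  show "f \<in> bergman_space \<Omega> \<longleftrightarrow> (\<integral>\<^sup>+z\<in>\<Omega>. ennreal ((norm (f z))\<^sup>2) \<partial>lborel) < \<infinity>"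
    using f meas unfolding eq bergman_space_def set_integrable_def set_borel_measurable_def
    by (auto simp: integrable_iff_bounded)
  show "f \<in> bergman_space \<Omega> \<Longrightarrow>
      (\<integral>\<^sup>+z\<in>\<Omega>. ennreal ((norm (f z))\<^sup>2) \<partial>lborel) = ennreal (bergman_norm2 \<Omega> f)"
    unfolding eq bergman_norm2_def set_lebesgue_integral_def
    by (rule nn_integral_eq_integral) (auto simp: bergman_space_def set_integrable_def)
qed

lemma bergman_norm2_nonneg: "bergman_norm2 \<Omega> f \<ge> 0"
  unfolding bergman_norm2_def set_lebesgue_integral_def by (intro integral_nonneg_AE) auto

lemma bergman_space_integrable_mult:
  fixes f g :: "complex ^ 'n \<Rightarrow> complex"
  assumes "open \<Omega>" and f: "f \<in> bergman_space \<Omega>" and g: "g \<in> bergman_space \<Omega>"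
  shows "set_integrable lborel \<Omega> (\<lambda>z. f z * cnj (g z))"
proof -
  have "continuous_on \<Omega> f" "continuous_on \<Omega> g"
    using f g by (auto simp: bergman_space_def intro: holomorphic_several_continuous_on)
  then have meas: "set_borel_measurable lborel \<Omega> (\<lambda>z. f z * cnj (g z))"
    using assms(1) by (intro set_borel_measurable_continuous continuous_intros)
  have int: "set_integrable lborel \<Omega> (\<lambda>z. (norm (f z))\<^sup>2 + (norm (g z))\<^sup>2)"
    using f g by (intro set_integral_add) (auto simp: bergman_space_def)
  have "norm (f z * cnj (g z)) \<le> norm ((norm (f z))\<^sup>2 + (norm (g z))\<^sup>2)" for z
  proof -
    have "2 * (norm (f z) * norm (g z)) \<le> (norm (f z))\<^sup>2 + (norm (g z))\<^sup>2"
      using sum_squares_bound[of "norm (f z)" "norm (g z)"] by simp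
    moreover have "0 \<le> norm (f z) * norm (g z)" by simp
    ultimately have "norm (f z) * norm (g z) \<le> (norm (f z))\<^sup>2 + (norm (g z))\<^sup>2" by linarith
    then show ?thesis by (simp add: norm_mult)
  qed
  then show ?thesis
    by (intro set_integrable_bound[OF int meas] always_eventually allI impI)
qed

lemma norm_add_mult_square:
  fixes a b c :: complex
  shows "(norm (a + c * b))\<^sup>2 = (norm a)\<^sup>2 + 2 * Re (cnj c * (a * cnj b)) + (norm c)\<^sup>2 * (norm b)\<^sup>2"
  unfolding cmod_power2 by (simp add: power2_eq_square algebra_simps)

lemma bergman_space_add_mult:
  fixes f g :: "complex ^ 'n \<Rightarrow> complex"
  assumes "open \<Omega>" and f: "f \<in> bergman_space \<Omega>" and g: "g \<in> bergman_space \<Omega>"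
  shows "(\<lambda>z. f z + c * g z) \<in> bergman_space \<Omega>"
    and "bergman_norm2 \<Omega> (\<lambda>z. f z + c * g z)
       = bergman_norm2 \<Omega> f + 2 * Re (cnj c * bergman_inner \<Omega> f g) + (norm c)\<^sup>2 * bergman_norm2 \<Omega> g"
proof -
  note int = bergman_space_integrable_mult[OF assms]
  have f2: "set_integrable lborel \<Omega> (\<lambda>z. (norm (f z))\<^sup>2)" and g2: "set_integrable lborel \<Omega> (\<lambda>z. (norm (g z))\<^sup>2)"
    using f g by (auto simp: bergman_space_def)
  have Re_int: "set_integrable lborel \<Omega> (\<lambda>z. Re (cnj c * (f z * cnj (g z))))"
    and Re_eq: "(LINT z:\<Omega>|lborel. Re (cnj c * (f z * cnj (g z)))) = Re (cnj c * bergman_inner \<Omega> f g)"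
  proof -
    have I: "integrable lborel (\<lambda>z. cnj c * (indicator \<Omega> z *\<^sub>R (f z * cnj (g z))))"
      using int unfolding set_integrable_def by (rule integrable_mult_right)
    have eq: "indicator \<Omega> z *\<^sub>R Re (cnj c * (f z * cnj (g z)))
        = Re (cnj c * (indicator \<Omega> z *\<^sub>R (f z * cnj (g z))))" for z
      by (simp split: split_indicator)
    show "set_integrable lborel \<Omega> (\<lambda>z. Re (cnj c * (f z * cnj (g z))))"
      unfolding set_integrable_def eq using I by (rule integrable_Re)
    show "(LINT z:\<Omega>|lborel. Re (cnj c * (f z * cnj (g z)))) = Re (cnj c * bergman_inner \<Omega> f g)"
      unfolding set_lebesgue_integral_def bergman_inner_def eq
      unfolding integral_Re[OF I] integral_mult_right_zero ..
  qed
  have sum_int: "set_integrable lborel \<Omega> (\<lambda>z. (norm (f z))\<^sup>2 + 2 * Re (cnj c * (f z * cnj (g z))))"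
    by (intro set_integral_add f2 set_integrable_mult_right Re_int)
  show "(\<lambda>z. f z + c * g z) \<in> bergman_space \<Omega>"
    unfolding bergman_space_def mem_Collect_eq
  proof
    show "holomorphic_several \<Omega> (\<lambda>z. f z + c * g z)"
      using f g unfolding bergman_space_def
      by (intro holomorphic_several_add holomorphic_several_mult holomorphic_several_const) auto
    show "set_integrable lborel \<Omega> (\<lambda>z. (norm (f z + c * g z))\<^sup>2)"
      unfolding norm_add_mult_square
      by (intro set_integral_add(1) sum_int set_integrable_mult_right g2)
  qed
  show "bergman_norm2 \<Omega> (\<lambda>z. f z + c * g z)
       = bergman_norm2 \<Omega> f + 2 * Re (cnj c * bergman_inner \<Omega> f g) + (norm c)\<^sup>2 * bergman_norm2 \<Omega> g"
    unfolding bergman_norm2_def norm_add_mult_square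
    by (subst set_integral_add(2)[OF sum_int set_integrable_mult_right[OF g2]],
        subst set_integral_add(2)[OF f2 set_integrable_mult_right[OF Re_int]],
        simp only: set_integral_mult_right Re_eq)
qed

lemma bergman_inner_add_mult:
  fixes f g h :: "complex ^ 'n \<Rightarrow> complex"
  assumes "open \<Omega>" "f \<in> bergman_space \<Omega>" "g \<in> bergman_space \<Omega>" "h \<in> bergman_space \<Omega>"
  shows "bergman_inner \<Omega> (\<lambda>z. f z + c * g z) h = bergman_inner \<Omega> f h + c * bergman_inner \<Omega> g h"
proof -
  have "bergman_inner \<Omega> (\<lambda>z. f z + c * g z) h
      = (LINT z:\<Omega>|lborel. f z * cnj (h z) + c * (g z * cnj (h z)))"
    unfolding bergman_inner_def by (simp add: algebra_simps)
  then show ?thesis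
    using assms by (simp add: bergman_inner_def set_integral_add bergman_space_integrable_mult set_integrable_mult_right)
qed

lemma bergman_inner_self: "bergman_inner \<Omega> f f = of_real (bergman_norm2 \<Omega> f)"
  unfolding bergman_inner_def bergman_norm2_def
  by (simp add: complex_norm_square[symmetric] set_integral_complex_of_real flip: of_real_power)

lemma bergman_inner_cnj: "cnj (bergman_inner \<Omega> f g) = bergman_inner \<Omega> g f"
  unfolding bergman_inner_def set_lebesgue_integral_def
  by (simp add: Bochner_Integration.integral_cnj[symmetric] mult.commute del: Bochner_Integration.integral_cnj)

lemma bergman_zero: "open \<Omega> \<Longrightarrow> (\<lambda>z. 0) \<in> bergman_space \<Omega>"
  by (simp add: bergman_space_def holomorphic_several_const set_integrable_def)

text \<open>
  The usual variational argument: if the inner product \<open>q\<close> were not zero, moving \<open>f\<close> a little in the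
  direction \<open>- q h\<close> would decrease the norm.
\<close>

lemma bergman_orthogonal_of_minimal:
  fixes f h :: "complex ^ 'n \<Rightarrow> complex"
  assumes "open \<Omega>" and f: "f \<in> bergman_space \<Omega>" and h: "h \<in> bergman_space \<Omega>"
    and min: "\<And>c. bergman_norm2 \<Omega> f \<le> bergman_norm2 \<Omega> (\<lambda>z. f z + c * h z)"
  shows "bergman_inner \<Omega> f h = 0"
proof (rule ccontr)
  define q where "q = bergman_inner \<Omega> f h"
  define A where "A = bergman_norm2 \<Omega> h"
  assume "bergman_inner \<Omega> f h \<noteq> 0"
  then have q: "norm q > 0" by (simp add: q_def)
  have A: "A \<ge> 0" by (simp add: A_def bergman_norm2_nonneg)
  \<comment> \<open>Small enough that the quadratic term \<open>t\<^sup>2 |q|\<^sup>2 A\<close> stays below the linear gain \<open>2 t |q|\<^sup>2\<close>.\<close>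
  define t where "t = 1 / (A + 1)"
  have t: "t > 0" "t * A < 1" using A by (simp_all add: t_def field_simps)
  define c where "c = - of_real t * q"
  have "Re (cnj c * q) = - t * (norm q)\<^sup>2"
    unfolding cmod_power2 by (simp add: c_def power2_eq_square algebra_simps)
  moreover have "(norm c)\<^sup>2 = t\<^sup>2 * (norm q)\<^sup>2"
    by (simp add: c_def norm_mult power_mult_distrib)
  ultimately have "0 \<le> - 2 * t * (norm q)\<^sup>2 + t\<^sup>2 * (norm q)\<^sup>2 * A"
    using min[of c] unfolding bergman_space_add_mult(2)[OF assms(1-3)] q_def[symmetric] A_def[symmetric] by simp
  also have "\<dots> = t * (norm q)\<^sup>2 * (t * A - 2)"
    by (simp add: power2_eq_square algebra_simps)
  also have "\<dots> < 0"
    using t q by (intro mult_pos_neg) auto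
  finally show False by simp
qed

text \<open>
  Evaluation at a point is a continuous functional on the Bergman space, with a bound that is locally
  uniform in the point; the balls inside \<open>\<Omega>\<close> make \<open>\<Omega>\<close> open. This is what makes the Bergman space a Hilbert space with a reproducing kernel.
\<close>

definition bounded_evaluation :: "(complex ^ 'n) set \<Rightarrow> bool"
  where "bounded_evaluation \<Omega> \<longleftrightarrow>
    (\<forall>z\<in>\<Omega>. \<exists>r>0. \<exists>C. ball z r \<subseteq> \<Omega> \<and>
       (\<forall>f\<in>bergman_space \<Omega>. \<forall>w\<in>ball z r. (norm (f w))\<^sup>2 \<le> C * bergman_norm2 \<Omega> f))"

lemma bounded_evaluation_open: "bounded_evaluation \<Omega> \<Longrightarrow> open \<Omega>"
  unfolding bounded_evaluation_def open_contains_ball by blast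

lemma bounded_evaluation_vanish:
  assumes "bounded_evaluation \<Omega>" "f \<in> bergman_space \<Omega>" "bergman_norm2 \<Omega> f = 0" "z \<in> \<Omega>"
  shows "f z = 0"
proof -
  obtain r C where "r > 0" and C: "\<forall>f\<in>bergman_space \<Omega>. \<forall>w\<in>ball z r. (norm (f w))\<^sup>2 \<le> C * bergman_norm2 \<Omega> f"
    using assms(1,4) unfolding bounded_evaluation_def by meson
  then have "(norm (f z))\<^sup>2 \<le> C * bergman_norm2 \<Omega> f"
    by (intro C[rule_format] assms(2)) simp
  then show ?thesis by (simp add: assms(3))
qed

text \<open>
  Completeness of the Bergman space. Locally bounded evaluations turn a Cauchy sequence in norm into a
  locally uniform Cauchy sequence; Fatou's lemma controls the norm of its limit.
\<close>

lemma bergman_cauchy_limit: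
  fixes F :: "nat \<Rightarrow> complex ^ 'n \<Rightarrow> complex"
  assumes ev: "bounded_evaluation \<Omega>" and F: "\<And>n. F n \<in> bergman_space \<Omega>"
    and cauchy: "\<And>e. e > 0 \<Longrightarrow> \<exists>N. \<forall>m\<ge>N. \<forall>n\<ge>N. bergman_norm2 \<Omega> (\<lambda>z. F m z - F n z) < e"
    and lim: "(\<lambda>n. bergman_norm2 \<Omega> (F n)) \<longlonglongrightarrow> L"
  obtains f where "f \<in> bergman_space \<Omega>" "bergman_norm2 \<Omega> f \<le> L"
    "\<And>z. z \<in> \<Omega> \<Longrightarrow> (\<lambda>n. F n z) \<longlonglongrightarrow> f z"
proof -
  have op: "open \<Omega>" using ev by (rule bounded_evaluation_open)
  define f where "f z = lim (\<lambda>n. F n z)" for z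
  have diff: "(\<lambda>z. F m z - F n z) \<in> bergman_space \<Omega>" for m n
    using bergman_space_add_mult(1)[OF op F[of m] F[of n], of "-1"] by simp
  have unif: "\<exists>r>0. uniform_limit (ball z r) F f sequentially" if z: "z \<in> \<Omega>" for z
  proof -
    obtain r C where r: "r > 0" "ball z r \<subseteq> \<Omega>"
      and C: "\<And>f w. f \<in> bergman_space \<Omega> \<Longrightarrow> w \<in> ball z r \<Longrightarrow> (norm (f w))\<^sup>2 \<le> C * bergman_norm2 \<Omega> f"
      using ev z unfolding bounded_evaluation_def by meson
    have "uniformly_Cauchy_on (ball z r) F"
      unfolding uniformly_Cauchy_on_def
    proof (intro allI impI)
      fix e :: real assume e: "e > 0"
      have "e\<^sup>2 / (\<bar>C\<bar> + 1) > 0" using e by (intro divide_pos_pos) auto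
      then obtain N where N: "\<And>m n. m \<ge> N \<Longrightarrow> n \<ge> N \<Longrightarrow>
          bergman_norm2 \<Omega> (\<lambda>z. F m z - F n z) < e\<^sup>2 / (\<bar>C\<bar> + 1)"
        using cauchy by meson
      have "dist (F m x) (F n x) < e" if "m \<ge> N" "n \<ge> N" "x \<in> ball z r" for m n x
      proof -
        have "(norm (F m x - F n x))\<^sup>2 \<le> C * bergman_norm2 \<Omega> (\<lambda>z. F m z - F n z)"
          using C[OF diff that(3)] .
        also have "\<dots> \<le> (\<bar>C\<bar> + 1) * bergman_norm2 \<Omega> (\<lambda>z. F m z - F n z)"
          by (intro mult_right_mono bergman_norm2_nonneg) auto
        also have "\<dots> < e\<^sup>2"
          using N[OF that(1,2)] by (simp add: field_simps)
        finally show ?thesis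
          using e by (simp add: dist_norm power2_less_imp_less)
      qed
      then show "\<exists>M. \<forall>x\<in>ball z r. \<forall>m\<ge>M. \<forall>n\<ge>M. dist (F m x) (F n x) < e" by blast
    qed
    then have "uniformly_convergent_on (ball z r) F"
      by (rule Cauchy_uniformly_convergent)
    then have "uniform_limit (ball z r) F f sequentially"
      unfolding f_def by (simp add: uniformly_convergent_uniform_limit_iff)
    with r show ?thesis by blast
  qed
  have hol: "holomorphic_several \<Omega> f"
    by (rule holomorphic_several_uniform_limit[OF op _ unif])
       (use F in \<open>auto simp: bergman_space_def\<close>)
  have ptw: "(\<lambda>n. F n z) \<longlonglongrightarrow> f z" if "z \<in> \<Omega>" for z
    using unif[OF that] by (auto intro: tendsto_uniform_limitI)
  have L0: "L \<ge> 0"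
    by (rule tendsto_lowerbound[OF lim]) (auto simp: bergman_norm2_nonneg)
  have "(\<integral>\<^sup>+z\<in>\<Omega>. ennreal ((norm (f z))\<^sup>2) \<partial>lborel)
      = (\<integral>\<^sup>+z. liminf (\<lambda>n. ennreal ((norm (F n z))\<^sup>2) * indicator \<Omega> z) \<partial>lborel)"
  proof (intro nn_integral_cong lim_imp_Liminf[symmetric])
    fix z :: "complex ^ 'n"
    show "(\<lambda>n. ennreal ((norm (F n z))\<^sup>2) * indicator \<Omega> z) \<longlonglongrightarrow> ennreal ((norm (f z))\<^sup>2) * indicator \<Omega> z"
      by (cases "z \<in> \<Omega>") (auto intro!: tendsto_intros ptw tendsto_ennrealI)
  qed simp
  also have "\<dots> \<le> liminf (\<lambda>n. \<integral>\<^sup>+z\<in>\<Omega>. ennreal ((norm (F n z))\<^sup>2) \<partial>lborel)"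
  proof (rule nn_integral_liminf)
    fix n
    show "(\<lambda>z. ennreal ((norm (F n z))\<^sup>2) * indicator \<Omega> z) \<in> borel_measurable lborel"
      using bergman_density_measurable[OF op, of "F n"] F[of n] by (simp add: bergman_space_def)
  qed
  also have "(\<lambda>n. \<integral>\<^sup>+z\<in>\<Omega>. ennreal ((norm (F n z))\<^sup>2) \<partial>lborel) = (\<lambda>n. ennreal (bergman_norm2 \<Omega> (F n)))"
    using F op by (intro ext bergman_space_nn_integral(2)) (auto simp: bergman_space_def)
  also have "liminf (\<lambda>n. ennreal (bergman_norm2 \<Omega> (F n))) = ennreal L"
    by (intro lim_imp_Liminf tendsto_ennrealI lim) simp
  finally have le: "(\<integral>\<^sup>+z\<in>\<Omega>. ennreal ((norm (f z))\<^sup>2) \<partial>lborel) \<le> ennreal L" .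
  then have fA: "f \<in> bergman_space \<Omega>"
    by (subst bergman_space_nn_integral(1)[OF op hol]) (auto simp: less_top[symmetric] top_unique)
  moreover have "bergman_norm2 \<Omega> f \<le> L"
    using le L0 by (simp add: bergman_space_nn_integral(2)[OF op hol fA])
  ultimately show ?thesis using that ptw by blast
qed

text \<open>
  The parallelogram law makes a minimizing sequence Cauchy, because the midpoint of two competitors is
  again a competitor and so has norm at least the infimum.
\<close>

lemma bergman_minimal_function:
  fixes \<Omega> :: "(complex ^ 'n) set"
  assumes ev: "bounded_evaluation \<Omega>" and z: "z \<in> \<Omega>"
    and ex: "\<exists>f\<in>bergman_space \<Omega>. f z \<noteq> 0"
  obtains f where "f \<in> bergman_space \<Omega>" "f z = 1"
    "\<And>g. g \<in> bergman_space \<Omega> \<Longrightarrow> g z = 1 \<Longrightarrow> bergman_norm2 \<Omega> f \<le> bergman_norm2 \<Omega> g"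
proof -
  have op: "open \<Omega>" using ev by (rule bounded_evaluation_open)
  define S where "S = {f \<in> bergman_space \<Omega>. f z = 1}"
  define L where "L = (INF f\<in>S. bergman_norm2 \<Omega> f)"
  obtain f0 where f0: "f0 \<in> bergman_space \<Omega>" "f0 z \<noteq> 0" using ex by blast
  have "(\<lambda>w. 0 + inverse (f0 z) * f0 w) \<in> bergman_space \<Omega>"
    by (intro bergman_space_add_mult bergman_zero op f0)
  then have S: "S \<noteq> {}" using f0 by (force simp: S_def)
  have bdd: "bdd_below (bergman_norm2 \<Omega> ` S)"
    by (rule bdd_belowI[of _ 0]) (auto simp: bergman_norm2_nonneg)
  have L: "L \<le> bergman_norm2 \<Omega> g" if "g \<in> S" for g
    unfolding L_def by (rule cINF_lower[OF bdd that])
  have "\<exists>g\<in>S. bergman_norm2 \<Omega> g < L + 1 / real (Suc n)" for n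
    using cINF_less_iff[OF S bdd, of "L + 1 / real (Suc n)"] by (simp add: L_def)
  then obtain F where F: "\<And>n. F n \<in> S" "\<And>n. bergman_norm2 \<Omega> (F n) < L + 1 / real (Suc n)"
    by metis
  have FA: "F n \<in> bergman_space \<Omega>" "F n z = 1" for n using F(1)[of n] by (auto simp: S_def)
  have lim: "(\<lambda>n. bergman_norm2 \<Omega> (F n)) \<longlonglongrightarrow> L"
  proof (rule tendsto_sandwich[where f = "\<lambda>_. L" and h = "\<lambda>n. L + 1 / real (Suc n)"])
    show "(\<lambda>n. L + 1 / real (Suc n)) \<longlonglongrightarrow> L"
      using tendsto_add[OF tendsto_const LIMSEQ_inverse_real_of_nat, of L] by (simp add: inverse_eq_divide)
    show "(\<lambda>n. L) \<longlonglongrightarrow> L" by simp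
    show "\<forall>\<^sub>F n in sequentially. L \<le> bergman_norm2 \<Omega> (F n)"
      by (intro always_eventually allI L F(1))
    show "\<forall>\<^sub>F n in sequentially. bergman_norm2 \<Omega> (F n) \<le> L + 1 / real (Suc n)"
      by (intro always_eventually allI less_imp_le F(2))
  qed
  have par: "bergman_norm2 \<Omega> (\<lambda>w. F m w - F n w)
      \<le> 2 * (bergman_norm2 \<Omega> (F m) - L) + 2 * (bergman_norm2 \<Omega> (F n) - L)" for m n
  proof -
    define q where "q = Re (bergman_inner \<Omega> (F m) (F n))"
    have 1: "bergman_norm2 \<Omega> (\<lambda>w. F m w - F n w) = bergman_norm2 \<Omega> (F m) - 2 * q + bergman_norm2 \<Omega> (F n)"
      using bergman_space_add_mult(2)[OF op FA(1)[of m] FA(1)[of n], of "-1"] by (simp add: q_def)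
    have 2: "bergman_norm2 \<Omega> (\<lambda>w. F m w + 1 * F n w) = bergman_norm2 \<Omega> (F m) + 2 * q + bergman_norm2 \<Omega> (F n)"
      using bergman_space_add_mult(2)[OF op FA(1)[of m] FA(1)[of n], of "1"] by (simp add: q_def)
    have sumA: "(\<lambda>w. F m w + 1 * F n w) \<in> bergman_space \<Omega>"
      by (intro bergman_space_add_mult op FA)
    have half: "(\<lambda>w. 0 + (1/2) * (F m w + 1 * F n w)) \<in> S"
      using bergman_space_add_mult(1)[OF op bergman_zero[OF op] sumA, of "1/2"] by (simp add: S_def FA)
    have "bergman_norm2 \<Omega> (\<lambda>w. 0 + (1/2) * (F m w + 1 * F n w)) = bergman_norm2 \<Omega> (\<lambda>w. F m w + 1 * F n w) / 4"
      unfolding bergman_space_add_mult(2)[OF op bergman_zero[OF op] sumA]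
      by (simp add: bergman_norm2_def bergman_inner_def norm_divide power2_eq_square)
    then have "4 * L \<le> bergman_norm2 \<Omega> (\<lambda>w. F m w + 1 * F n w)"
      using L[OF half] by simp
    then have "4 * L \<le> bergman_norm2 \<Omega> (F m) + 2 * q + bergman_norm2 \<Omega> (F n)"
      unfolding 2 .
    then show ?thesis unfolding 1 by argo
  qed
  have cauchy: "\<exists>N. \<forall>m\<ge>N. \<forall>n\<ge>N. bergman_norm2 \<Omega> (\<lambda>w. F m w - F n w) < e" if e: "e > 0" for e
  proof -
    have "\<forall>\<^sub>F n in sequentially. bergman_norm2 \<Omega> (F n) < L + e / 4"
      by (rule order_tendstoD[OF lim]) (use e in auto)
    then obtain N where N: "\<And>n. n \<ge> N \<Longrightarrow> bergman_norm2 \<Omega> (F n) < L + e / 4"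
      unfolding eventually_sequentially by blast
    have "bergman_norm2 \<Omega> (\<lambda>w. F m w - F n w) < e" if "m \<ge> N" "n \<ge> N" for m n
      using par[of m n] N[OF that(1)] N[OF that(2)] by argo
    then show ?thesis by blast
  qed
  obtain f where f: "f \<in> bergman_space \<Omega>" "bergman_norm2 \<Omega> f \<le> L"
      "\<And>w. w \<in> \<Omega> \<Longrightarrow> (\<lambda>n. F n w) \<longlonglongrightarrow> f w"
    using bergman_cauchy_limit[OF ev FA(1) cauchy lim] by blast
  have "f z = 1"
    using f(3)[OF z] by (simp add: FA LIMSEQ_const_iff)
  then show ?thesis
    using f L by (intro that[of f]) (auto simp: S_def intro: order_trans)
qed

text \<open>
  The minimizer \<open>f\<close> with \<open>f z = 1\<close> is orthogonal to every function vanishing at \<open>z\<close>. Splitting \<open>g\<close> as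
  \<open>g z \<cdot> f\<close> plus such a function gives \<open>\<langle>g, f\<rangle> = g z \<cdot> \<parallel>f\<parallel>\<^sup>2\<close>, which is the reproducing property of
  the conjugate of \<open>f / \<parallel>f\<parallel>\<^sup>2\<close>. Two reproducing functions differ by one of norm zero.
\<close>

lemma bergman_kernel_characterization:
  fixes \<Omega> :: "(complex ^ 'n) set"
  assumes ev: "bounded_evaluation \<Omega>" and z: "z \<in> \<Omega>"
  shows "(\<forall>w. w \<notin> \<Omega> \<longrightarrow> bergman_kernel \<Omega> z w = 0) \<and>
      (\<lambda>w. cnj (bergman_kernel \<Omega> z w)) \<in> bergman_space \<Omega> \<and>
      (\<forall>f\<in>bergman_space \<Omega>. f z = (LINT w:\<Omega>|lborel. bergman_kernel \<Omega> z w * f w))"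
proof -
  have op: "open \<Omega>" using ev by (rule bounded_evaluation_open)
  define P where "P g \<longleftrightarrow> (\<forall>w. w \<notin> \<Omega> \<longrightarrow> g w = 0) \<and> (\<lambda>w. cnj (g w)) \<in> bergman_space \<Omega> \<and>
      (\<forall>f\<in>bergman_space \<Omega>. f z = (LINT w:\<Omega>|lborel. g w * f w))" for g
  have "\<exists>g. P g"
  proof (cases "\<exists>f\<in>bergman_space \<Omega>. f z \<noteq> 0")
    case False
    then have "P (\<lambda>_. 0)"
      using bergman_zero[OF op] by (auto simp: P_def)
    then show ?thesis by (rule exI[of P])
  next
    case True
    obtain f where f: "f \<in> bergman_space \<Omega>" "f z = 1"
      and min: "\<And>g. g \<in> bergman_space \<Omega> \<Longrightarrow> g z = 1 \<Longrightarrow> bergman_norm2 \<Omega> f \<le> bergman_norm2 \<Omega> g"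
      using bergman_minimal_function[OF ev z True] by blast
    define m where "m = bergman_norm2 \<Omega> f"
    have m: "m > 0"
    proof -
      have "m \<noteq> 0"
        using bounded_evaluation_vanish[OF ev f(1) _ z] f(2) by (auto simp: m_def)
      then show ?thesis using bergman_norm2_nonneg[of \<Omega> f] by (simp add: m_def)
    qed
    have repr: "bergman_inner \<Omega> g f = g z * of_real m" if g: "g \<in> bergman_space \<Omega>" for g
    proof -
      define h where "h w = g w + (- g z) * f w" for w
      have h: "h \<in> bergman_space \<Omega>" unfolding h_def by (rule bergman_space_add_mult(1)[OF op g f(1)])
      have "bergman_inner \<Omega> f h = 0"
      proof (rule bergman_orthogonal_of_minimal[OF op f(1) h])
        show "bergman_norm2 \<Omega> f \<le> bergman_norm2 \<Omega> (\<lambda>w. f w + c * h w)" for c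
          by (intro min bergman_space_add_mult(1) op f h) (simp add: h_def f)
      qed
      then have "bergman_inner \<Omega> h f = 0"
        using bergman_inner_cnj[of \<Omega> f h] by simp
      moreover have "bergman_inner \<Omega> h f = bergman_inner \<Omega> g f - g z * of_real m"
        unfolding h_def bergman_inner_add_mult[OF op g f(1) f(1)] m_def by (simp add: bergman_inner_self)
      ultimately show ?thesis by simp
    qed
    define G where "G w = (if w \<in> \<Omega> then cnj (f w) / of_real m else 0)" for w
    have "P G"
      unfolding P_def
    proof (intro conjI allI ballI impI)
      have eq: "(\<lambda>w. indicator \<Omega> w *\<^sub>R (norm (cnj (G w)))\<^sup>2)
          = (\<lambda>w. indicator \<Omega> w *\<^sub>R (norm (0 + inverse (of_real m) * f w))\<^sup>2)"
        by (auto simp: fun_eq_iff G_def norm_divide norm_mult norm_inverse field_simps split: split_indicator)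
      have A: "(\<lambda>w. 0 + inverse (of_real m) * f w) \<in> bergman_space \<Omega>"
        by (intro bergman_space_add_mult bergman_zero op f)
      then have "holomorphic_several \<Omega> (\<lambda>w. 0 + inverse (of_real m) * f w)"
        by (simp add: bergman_space_def)
      then have "holomorphic_several \<Omega> (\<lambda>w. cnj (G w))"
        by (rule holomorphic_several_cong[OF op]) (simp add: G_def divide_inverse mult.commute)
      then show "(\<lambda>w. cnj (G w)) \<in> bergman_space \<Omega>"
        using A unfolding bergman_space_def set_integrable_def mem_Collect_eq eq by blast
    next
      fix g assume g: "g \<in> bergman_space \<Omega>"
      have "(LINT w:\<Omega>|lborel. G w * g w) = (LINT w:\<Omega>|lborel. inverse (of_real m) * (g w * cnj (f w)))"
        unfolding set_lebesgue_integral_def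
        by (intro Bochner_Integration.integral_cong) (auto simp: G_def field_simps split: split_indicator)
      also have "\<dots> = inverse (of_real m) * bergman_inner \<Omega> g f"
        by (simp add: bergman_inner_def)
      also have "\<dots> = g z" using m by (simp add: repr[OF g])
      finally show "g z = (LINT w:\<Omega>|lborel. G w * g w)" ..
    qed (simp add: G_def)
    then show ?thesis by (rule exI[of P])
  qed
  moreover have "g1 = g2" if g1: "P g1" and g2: "P g2" for g1 g2
  proof -
    define d where "d w = cnj (g1 w) + (-1) * cnj (g2 w)" for w
    have cA: "(\<lambda>w. cnj (g1 w)) \<in> bergman_space \<Omega>" "(\<lambda>w. cnj (g2 w)) \<in> bergman_space \<Omega>"
      using g1 g2 by (auto simp: P_def)
    have d: "d \<in> bergman_space \<Omega>"
      unfolding d_def by (intro bergman_space_add_mult op cA)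
    have "bergman_inner \<Omega> d (\<lambda>w. cnj (g w)) = d z" if "P g" for g
      using that d by (simp add: P_def bergman_inner_def mult.commute)
    then have "bergman_inner \<Omega> d (\<lambda>w. cnj (g1 w)) = bergman_inner \<Omega> d (\<lambda>w. cnj (g2 w))"
      using g1 g2 by simp
    then have "bergman_inner \<Omega> (\<lambda>w. cnj (g1 w)) d = bergman_inner \<Omega> (\<lambda>w. cnj (g2 w)) d"
      by (metis bergman_inner_cnj)
    then have "bergman_inner \<Omega> d d = 0"
      unfolding d_def[abs_def] using bergman_inner_add_mult[OF op cA d, of "-1"] by (simp add: d_def[abs_def])
    then have N0: "bergman_norm2 \<Omega> d = 0" by (simp add: bergman_inner_self)
    have "d w = 0" if "w \<in> \<Omega>" for w
      by (rule bounded_evaluation_vanish[OF ev d N0 that])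
    then have "cnj (g1 w) = cnj (g2 w)" if "w \<in> \<Omega>" for w
      using that by (simp add: d_def)
    moreover have "g1 w = g2 w" if "w \<notin> \<Omega>" for w
      using g1 g2 that by (simp add: P_def)
    ultimately show "g1 = g2"
      by (metis complex_cnj_cancel_iff ext)
  qed
  ultimately have "\<exists>!g. P g" by blast
  then have "P (THE g. P g)" by (rule theI')
  then show ?thesis
    unfolding P_def[abs_def] bergman_kernel_def .
qed

text \<open>
  The value \<open>B\<close> on the diagonal is the squared norm of the kernel function \<open>G\<close>. The second part is the
  Cauchy-Schwarz inequality for \<open>f\<close> and \<open>G\<close>, and the third tests the hypothesis on \<open>G\<close>.
\<close>

lemma bergman_kernel_diagonal:
  fixes \<Omega> :: "(complex ^ 'n) set"
  assumes ev: "bounded_evaluation \<Omega>" and z: "z \<in> \<Omega>"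
  shows "bergman_kernel \<Omega> z z \<in> \<real>"
    and "\<And>f. f \<in> bergman_space \<Omega> \<Longrightarrow>
      (norm (f z))\<^sup>2 \<le> Re (bergman_kernel \<Omega> z z) * bergman_norm2 \<Omega> f"
    and "0 \<le> A \<Longrightarrow> (\<And>f. f \<in> bergman_space \<Omega> \<Longrightarrow> (norm (f z))\<^sup>2 \<le> A * bergman_norm2 \<Omega> f) \<Longrightarrow>
      Re (bergman_kernel \<Omega> z z) \<le> A"
proof -
  have op: "open \<Omega>" using ev by (rule bounded_evaluation_open)
  define G where "G w = cnj (bergman_kernel \<Omega> z w)" for w
  define B where "B = bergman_norm2 \<Omega> G"
  note char = bergman_kernel_characterization[OF ev z]
  have G: "G \<in> bergman_space \<Omega>" using char by (simp add: G_def[abs_def])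
  have repr: "bergman_inner \<Omega> f G = f z" if "f \<in> bergman_space \<Omega>" for f
    using char that by (simp add: bergman_inner_def G_def mult.commute)
  have "G z = of_real B"
    using repr[OF G] by (simp add: bergman_inner_self B_def)
  then have K: "bergman_kernel \<Omega> z z = of_real B"
    by (metis G_def complex_cnj_cnj complex_cnj_complex_of_real)
  have B0: "B \<ge> 0" by (simp add: B_def bergman_norm2_nonneg)
  show "bergman_kernel \<Omega> z z \<in> \<real>" by (simp add: K)
  show "(norm (f z))\<^sup>2 \<le> Re (bergman_kernel \<Omega> z z) * bergman_norm2 \<Omega> f" if f: "f \<in> bergman_space \<Omega>" for f
  proof -
    define N where "N = bergman_norm2 \<Omega> f"
    have ineq: "0 \<le> N - 2 * t * (norm (f z))\<^sup>2 + t\<^sup>2 * (norm (f z))\<^sup>2 * B" for t :: real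
    proof -
      define c where "c = - of_real t * f z"
      have "0 \<le> bergman_norm2 \<Omega> (\<lambda>w. f w + c * G w)" by (rule bergman_norm2_nonneg)
      also have "\<dots> = N + 2 * Re (cnj c * f z) + (norm c)\<^sup>2 * B"
        by (simp add: bergman_space_add_mult(2)[OF op f G] repr[OF f] N_def B_def)
      also have "Re (cnj c * f z) = - t * (norm (f z))\<^sup>2"
        unfolding cmod_power2 by (simp add: c_def power2_eq_square algebra_simps)
      also have "(norm c)\<^sup>2 = t\<^sup>2 * (norm (f z))\<^sup>2"
        by (simp add: c_def norm_mult power_mult_distrib)
      finally show ?thesis by simp
    qed
    show ?thesis
    proof (cases "B = 0")
      case True
      have "(norm (f z))\<^sup>2 = 0"
      proof (rule ccontr)
        assume "(norm (f z))\<^sup>2 \<noteq> 0"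
        \<comment> \<open>With \<open>B = 0\<close> the quadratic in \<open>t\<close> is affine and becomes negative for large \<open>t\<close>.\<close>
        then have "N - 2 * ((N + 1) / (norm (f z))\<^sup>2) * (norm (f z))\<^sup>2 = N - 2 * (N + 1)" by simp
        then show False
          using ineq[of "(N + 1) / (norm (f z))\<^sup>2"] True bergman_norm2_nonneg[of \<Omega> f]
          by (simp add: N_def)
      qed
      then show ?thesis by (simp add: K True)
    next
      case False
      then have "B > 0" using B0 by simp
      then have "0 \<le> N - (norm (f z))\<^sup>2 / B"
        using ineq[of "1 / B"] by (simp add: power2_eq_square)
      then show ?thesis using \<open>B > 0\<close> by (simp add: K N_def field_simps)
    qed
  qed
  show "Re (bergman_kernel \<Omega> z z) \<le> A"
    if A: "0 \<le> A" and le: "\<And>f. f \<in> bergman_space \<Omega> \<Longrightarrow> (norm (f z))\<^sup>2 \<le> A * bergman_norm2 \<Omega> f"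
  proof -
    have "B\<^sup>2 \<le> A * B"
      using le[OF G] \<open>G z = of_real B\<close> by (simp add: B_def)
    then show ?thesis
      using B0 A by (cases "B = 0") (auto simp: K power2_eq_square)
  qed
qed

section \<open>Pointwise bounds in dimension two and the boundary distance\<close>

text \<open>
  The submean inequality is applied first along the holomorphic graph \<open>w \<mapsto> (\<phi> w, w)\<close> and then, for each
  \<open>w\<close>, on the horizontal disc centred on the graph. For constant \<open>\<phi>\<close> this is an ordinary polydisc;
  a suitable \<open>\<phi>\<close> lets the polydisc follow a curved boundary.
\<close>

lemma slanted_polydisc_submean:
  fixes f :: "complex ^ 2 \<Rightarrow> complex"
  assumes "open \<Omega>" and f: "holomorphic_several \<Omega> f" and \<phi>: "\<phi> holomorphic_on ball p c"
    and "c > 0" "\<tau> > 0"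
    and sub: "\<And>w x. w \<in> ball p c \<Longrightarrow> x \<in> ball (\<phi> w) \<tau> \<Longrightarrow> vector [x, w] \<in> \<Omega>"
  shows "ennreal ((norm (f (vector [\<phi> p, p])))\<^sup>2 * (pi * c\<^sup>2) * (pi * \<tau>\<^sup>2))
      \<le> (\<integral>\<^sup>+z\<in>\<Omega>. ennreal ((norm (f z))\<^sup>2) \<partial>lborel)"
proof -
  define h where "h z = ennreal ((norm (f z))\<^sup>2) * indicator \<Omega> z" for z
  have h [measurable]: "h \<in> borel_measurable borel"
    unfolding h_def by (rule bergman_density_measurable) fact+
  have inner: "ennreal ((norm (f (vector [\<phi> w, w])))\<^sup>2) * ennreal (pi * \<tau>\<^sup>2)
      \<le> (\<integral>\<^sup>+x. h (vector [x, w]) \<partial>lborel)" if w: "w \<in> ball p c" for w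
  proof -
    have "(\<lambda>x. f (vector [x, w])) holomorphic_on ball (\<phi> w) \<tau>"
    proof (rule holomorphic_several_curve[OF f])
      show "(\<lambda>x. vector [x, w] $ i) holomorphic_on ball (\<phi> w) \<tau>" for i :: 2
        using exhaust_2[of i] by (auto intro!: holomorphic_intros)
    qed (use sub[OF w] in auto)
    from holomorphic_disc_submean[OF this]
    have "ennreal ((norm (f (vector [\<phi> w, w])))\<^sup>2) * ennreal (pi * \<tau>\<^sup>2)
        \<le> (\<integral>\<^sup>+x\<in>ball (\<phi> w) \<tau>. ennreal ((norm (f (vector [x, w])))\<^sup>2) \<partial>lborel)"
      using \<open>\<tau> > 0\<close> by (simp add: emeasure_ball unit_ball_vol_2)
    also have "\<dots> \<le> (\<integral>\<^sup>+x. h (vector [x, w]) \<partial>lborel)"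
      by (intro nn_integral_mono) (auto simp: h_def sub[OF w] split: split_indicator)
    finally show ?thesis .
  qed
  have "(\<lambda>w. f (vector [\<phi> w, w])) holomorphic_on ball p c"
  proof (rule holomorphic_several_curve[OF f])
    show "(\<lambda>w. vector [\<phi> w, w] $ i) holomorphic_on ball p c" for i :: 2
      using exhaust_2[of i] by (auto intro!: holomorphic_intros \<phi>)
  qed (use sub \<open>\<tau> > 0\<close> in auto)
  from holomorphic_disc_submean[OF this]
  have "ennreal ((norm (f (vector [\<phi> p, p])))\<^sup>2) * ennreal (pi * c\<^sup>2)
      \<le> (\<integral>\<^sup>+w\<in>ball p c. ennreal ((norm (f (vector [\<phi> w, w])))\<^sup>2) \<partial>lborel)"
    using \<open>c > 0\<close> by (simp add: emeasure_ball unit_ball_vol_2)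
  then have "ennreal ((norm (f (vector [\<phi> p, p])))\<^sup>2) * ennreal (pi * c\<^sup>2) * ennreal (pi * \<tau>\<^sup>2)
      \<le> (\<integral>\<^sup>+w\<in>ball p c. ennreal ((norm (f (vector [\<phi> w, w])))\<^sup>2) \<partial>lborel) * ennreal (pi * \<tau>\<^sup>2)"
    by (rule mult_right_mono) simp
  also have "\<dots> = (\<integral>\<^sup>+w. ennreal ((norm (f (vector [\<phi> w, w])))\<^sup>2) * indicator (ball p c) w * ennreal (pi * \<tau>\<^sup>2) \<partial>lborel)"
  proof (rule nn_integral_multc[symmetric])
    have "continuous_on (ball p c) (\<lambda>w. (norm (f (vector [\<phi> w, w])))\<^sup>2)"
      using \<open>(\<lambda>w. f (vector [\<phi> w, w])) holomorphic_on ball p c\<close>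
      by (intro continuous_intros holomorphic_on_imp_continuous_on)
    then have "(\<lambda>w. ennreal (indicator (ball p c) w *\<^sub>R (norm (f (vector [\<phi> w, w])))\<^sup>2)) \<in> borel_measurable lborel"
      using set_borel_measurable_continuous[of "ball p c" "\<lambda>w. (norm (f (vector [\<phi> w, w])))\<^sup>2"]
      unfolding set_borel_measurable_def by simp
    moreover have "(\<lambda>w. ennreal (indicator (ball p c) w *\<^sub>R (norm (f (vector [\<phi> w, w])))\<^sup>2))
        = (\<lambda>w. ennreal ((norm (f (vector [\<phi> w, w])))\<^sup>2) * indicator (ball p c) w)"
      by (auto simp: fun_eq_iff split: split_indicator)
    ultimately show "(\<lambda>w. ennreal ((norm (f (vector [\<phi> w, w])))\<^sup>2) * indicator (ball p c) w) \<in> borel_measurable lborel"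
      by (simp only:)
  qed
  also have "\<dots> \<le> (\<integral>\<^sup>+w. \<integral>\<^sup>+x. h (vector [x, w]) \<partial>lborel \<partial>lborel)"
    by (intro nn_integral_mono) (use inner in \<open>auto split: split_indicator\<close>)
  also have "\<dots> = (\<integral>\<^sup>+z. h z \<partial>lborel)"
    by (rule nn_integral_complex_vec2[symmetric]) fact
  finally show ?thesis
    by (simp add: h_def ennreal_mult)
qed

lemma slanted_polydisc_bergman_bound:
  fixes f :: "complex ^ 2 \<Rightarrow> complex"
  assumes "open \<Omega>" and f: "f \<in> bergman_space \<Omega>" and "\<phi> holomorphic_on ball p c" "c > 0" "\<tau> > 0"
    and "\<And>w x. w \<in> ball p c \<Longrightarrow> x \<in> ball (\<phi> w) \<tau> \<Longrightarrow> vector [x, w] \<in> \<Omega>"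
  shows "(norm (f (vector [\<phi> p, p])))\<^sup>2 * (pi * c\<^sup>2) * (pi * \<tau>\<^sup>2) \<le> bergman_norm2 \<Omega> f"
proof -
  have hol: "holomorphic_several \<Omega> f" using f by (simp add: bergman_space_def)
  show ?thesis
    using slanted_polydisc_submean[OF assms(1) hol assms(3-6)]
    unfolding bergman_space_nn_integral(2)[OF assms(1) hol f]
    by (simp add: ennreal_le_iff bergman_norm2_nonneg)
qed

lemma norm_complex_vec2_le: "norm (z :: complex ^ 2) \<le> norm (z $ 1) + norm (z $ 2)"
  unfolding norm_vec_def using L2_set_le_sum[of UNIV "\<lambda>i. norm (z $ i)"] by (simp add: sum_2)

lemma vec2_eta: "vector [z $ 1, z $ 2] = (z :: complex ^ 2)"
  by (simp add: vec_eq_iff forall_2)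

lemma open_bounded_evaluation_vec2:
  fixes \<Omega> :: "(complex ^ 2) set"
  assumes "open \<Omega>"
  shows "bounded_evaluation \<Omega>"
  unfolding bounded_evaluation_def
proof
  fix z assume "z \<in> \<Omega>"
  then obtain e where e: "e > 0" "ball z e \<subseteq> \<Omega>"
    using assms by (meson openE)
  define V where "V = (pi * (e / 4)\<^sup>2) * (pi * (e / 4)\<^sup>2)"
  have V: "V > 0" using e by (simp add: V_def)
  have "(norm (f w))\<^sup>2 \<le> inverse V * bergman_norm2 \<Omega> f"
    if f: "f \<in> bergman_space \<Omega>" and w: "w \<in> ball z (e / 2)" for f w
  proof -
    have "(norm (f (vector [w $ 1, w $ 2])))\<^sup>2 * (pi * (e / 4)\<^sup>2) * (pi * (e / 4)\<^sup>2) \<le> bergman_norm2 \<Omega> f"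
    proof (rule slanted_polydisc_bergman_bound[OF assms f, where \<phi> = "\<lambda>_. w $ 1"])
      fix y x assume y: "y \<in> ball (w $ 2) (e / 4)" and x: "x \<in> ball (w $ 1) (e / 4)"
      have "norm (w - vector [x, y]) < e / 2"
        using norm_complex_vec2_le[of "w - vector [x, y]"] x y by (simp add: dist_norm)
      then have "dist z (vector [x, y]) < e"
        using w dist_triangle[of z "vector [x, y]" w] by (simp add: dist_norm)
      then show "vector [x, y] \<in> \<Omega>" using e by auto
    qed (use e in auto)
    then show ?thesis
      using V by (simp add: vec2_eta V_def field_simps)
  qed
  then show "\<exists>r>0. \<exists>C. ball z r \<subseteq> \<Omega> \<and>
      (\<forall>f\<in>bergman_space \<Omega>. \<forall>w\<in>ball z r. (norm (f w))\<^sup>2 \<le> C * bergman_norm2 \<Omega> f)"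
    using e by (intro exI[of _ "e / 2"] conjI exI[of _ "inverse V"]) auto
qed

lemma open_hartogs_triangle: "open (hartogs_triangle k)"
  unfolding hartogs_triangle_def
  by (intro open_Collect_conj open_Collect_less continuous_intros)

text \<open>
  Makes \<open>|z\<^sub>1|\<^sup>k\<close> a Lipschitz function of \<open>z\<^sub>1\<close> on the unit disc.
\<close>

lemma power_diff_le_mult_diff:
  fixes a b :: real
  assumes "0 \<le> b" "b \<le> a" "a \<le> 1"
  shows "a ^ n - b ^ n \<le> real n * (a - b)"
proof (induction n)
  case (Suc n)
  have "a ^ Suc n - b ^ Suc n = a * (a ^ n - b ^ n) + (a - b) * b ^ n"
    by (simp add: algebra_simps)
  also have "\<dots> \<le> 1 * (a ^ n - b ^ n) + (a - b) * 1"
    using assms by (intro add_mono mult_mono power_mono mult_left_mono power_le_one) (auto intro: power_mono)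
  also have "\<dots> \<le> real (Suc n) * (a - b)"
    using Suc by (simp add: algebra_simps)
  finally show ?case .
qed simp

text \<open>
  Shrinking \<open>z\<^sub>2\<close> radially by \<open>\<rho>\<close> leaves the domain, which bounds the distance from above. Conversely
  \<open>\<rho>\<close> is Lipschitz with constant \<open>1 + k\<close> and is not positive on the part of the boundary where
  \<open>|z\<^sub>2| < 1\<close>; the rest of the boundary is at distance at least \<open>1/2\<close>.
\<close>

lemma hartogs_boundary_distance:
  assumes "k > 0" and z: "z \<in> hartogs_triangle k" and small: "norm z < 1 / 2"
  defines "\<rho> \<equiv> norm (z $ 2) - norm (z $ 1) ^ k"
  shows "boundary_distance (hartogs_triangle k) z \<le> \<rho>"
    and "\<rho> \<le> (1 + real k) * boundary_distance (hartogs_triangle k) z"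
proof -
  let ?H = "hartogs_triangle k"
  have z12: "norm (z $ 1) ^ k < norm (z $ 2)" using z by (simp add: hartogs_triangle_def)
  have z0: "norm (z $ 2) > 0" using z12 by (rule le_less_trans[rotated]) simp
  define y :: "complex ^ 2" where "y = vector [z $ 1, of_real (norm (z $ 1) ^ k / norm (z $ 2)) * z $ 2]"
  have "y \<notin> ?H"
    using z0 by (simp add: hartogs_triangle_def y_def norm_mult norm_divide norm_power)
  have "dist z y \<le> norm ((z - y) $ 1) + norm ((z - y) $ 2)"
    unfolding dist_norm by (rule norm_complex_vec2_le)
  also have "(z - y) $ 2 = of_real (1 - norm (z $ 1) ^ k / norm (z $ 2)) * z $ 2"
    by (simp add: y_def algebra_simps)
  also have "norm \<dots> = \<bar>1 - norm (z $ 1) ^ k / norm (z $ 2)\<bar> * norm (z $ 2)"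
    by (simp only: norm_mult norm_of_real)
  also have "\<bar>1 - norm (z $ 1) ^ k / norm (z $ 2)\<bar> = 1 - norm (z $ 1) ^ k / norm (z $ 2)"
    using z12 z0 by (simp add: abs_of_nonneg)
  also have "norm ((z - y) $ 1) + (1 - norm (z $ 1) ^ k / norm (z $ 2)) * norm (z $ 2) = \<rho>"
    using z0 by (simp add: y_def \<rho>_def field_simps)
  finally have "dist z y \<le> \<rho>" .
  have "closed_segment z y \<inter> frontier ?H \<noteq> {}"
    by (rule connected_Int_frontier) (use z \<open>y \<notin> ?H\<close> in auto)
  then obtain x where x: "x \<in> closed_segment z y" "x \<in> frontier ?H" by blast
  have front: "frontier ?H \<noteq> {}" using x by blast
  have "infdist z (frontier ?H) \<le> dist z x" by (rule infdist_le) (rule x)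
  also have "\<dots> \<le> dist z y"
    using segment_bound(1)[OF x(1)] by (simp add: dist_norm norm_minus_commute)
  finally show "boundary_distance ?H z \<le> \<rho>"
    using \<open>dist z y \<le> \<rho>\<close> by (simp add: boundary_distance_def)
  have "\<rho> / (1 + real k) \<le> infdist z (frontier ?H)"
    unfolding infdist_notempty[OF front]
  proof (rule cINF_greatest[OF front])
    fix y assume y: "y \<in> frontier ?H"
    then have "y \<notin> ?H"
      using open_hartogs_triangle[of k] by (simp add: frontier_def interior_open)
    have "?H \<subseteq> {v. norm (v $ 1) \<le> 1}"
    proof safe
      fix v assume "v \<in> ?H"
      then have "norm (v $ 1) ^ k < 1" by (simp add: hartogs_triangle_def)
      then show "norm (v $ 1) \<le> 1"
        by (meson not_le one_le_power less_imp_le linorder_not_less)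
    qed
    moreover have "closed {v :: complex ^ 2. norm (v $ 1) \<le> 1}"
      by (intro closed_Collect_le continuous_intros)
    ultimately have "closure ?H \<subseteq> {v. norm (v $ 1) \<le> 1}" by (rule closure_minimal)
    then have y1: "norm (y $ 1) \<le> 1" using y by (auto simp: frontier_def)
    have z1: "norm (z $ 1) \<le> 1" "norm (z $ 2) < 1 / 2"
      using small Finite_Cartesian_Product.norm_nth_le[of z 1] Finite_Cartesian_Product.norm_nth_le[of z 2] by linarith+
    have d: "norm (z $ i - y $ i) \<le> dist z y" for i
      using Finite_Cartesian_Product.norm_nth_le[of "z - y" i] by (simp add: dist_norm)
    have "\<rho> \<le> (1 + real k) * dist z y"
    proof (cases "norm (y $ 2) < 1")
      case True
      then have y2: "norm (y $ 2) \<le> norm (y $ 1) ^ k"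
        using \<open>y \<notin> ?H\<close> by (simp add: hartogs_triangle_def)
      have "norm (y $ 1) ^ k - norm (z $ 1) ^ k \<le> real k * norm (z $ 1 - y $ 1)"
      proof (cases "norm (z $ 1) \<le> norm (y $ 1)")
        case True
        then have "norm (y $ 1) ^ k - norm (z $ 1) ^ k \<le> real k * (norm (y $ 1) - norm (z $ 1))"
          using y1 by (intro power_diff_le_mult_diff) auto
        also have "\<dots> \<le> real k * norm (z $ 1 - y $ 1)"
          by (intro mult_left_mono) (simp_all add: norm_minus_commute norm_triangle_ineq2)
        finally show ?thesis .
      next
        case False
        then have "norm (y $ 1) ^ k \<le> norm (z $ 1) ^ k" by (intro power_mono) auto
        then show ?thesis by (smt (verit) mult_nonneg_nonneg norm_ge_zero of_nat_0_le_iff)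
      qed
      also have "\<dots> \<le> real k * dist z y" by (intro mult_left_mono d) simp
      finally have "\<rho> \<le> norm (z $ 2) - norm (y $ 2) + real k * dist z y"
        using y2 by (simp add: \<rho>_def)
      also have "norm (z $ 2) - norm (y $ 2) \<le> dist z y"
        using d[of 2] norm_triangle_ineq2[of "z $ 2" "y $ 2"] by linarith
      finally show ?thesis by (simp add: algebra_simps)
    next
      case False
      then have "1 / 2 \<le> dist z y"
        using z1 d[of 2] norm_triangle_ineq2[of "y $ 2" "z $ 2"] by (simp add: norm_minus_commute)
      moreover have "\<rho> \<le> 1 / 2" using z1 by (simp add: \<rho>_def add_increasing2 algebra_simps)
      moreover have "1 * dist z y \<le> (1 + real k) * dist z y" by (intro mult_right_mono) auto
      ultimately show ?thesis by linarith
    qed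
    then show "\<rho> / (1 + real k) \<le> dist z y"
      by (simp add: field_simps)
  qed
  then show "\<rho> \<le> (1 + real k) * boundary_distance ?H z"
    by (simp add: boundary_distance_def field_simps)
qed

section \<open>The upper bound on the Hartogs triangle\<close>

text \<open>
  The slanted polydisc follows the branch \<open>(w / q\<^sub>2)\<^bsup>1/k\<^esup>\<close> over the disc of radius \<open>1/4\<close> around \<open>q\<^sub>2\<close>.
  Over \<open>w\<close> the domain is the disc of radius \<open>|w|\<^bsup>1/k\<^esup>\<close>, and the distance of the graph to its edge is
  the fixed number \<open>\<sigma> - |q\<^sub>1|\<close>, where \<open>\<sigma> = 2\<^bsup>-1/k\<^esup>\<close>, scaled by \<open>|w / q\<^sub>2|\<^bsup>1/k\<^esup> \<ge> 1/2\<close>. So half of that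
  number is an admissible radius \<open>\<tau>\<close> for all \<open>w\<close>.
\<close>

lemma hartogs_shell_estimate:
  assumes "k > 0" and f: "f \<in> bergman_space (hartogs_triangle k)"
    and q2: "norm q2 = 1 / 2" and q1: "norm q1 ^ k < 1 / 2"
  shows "(norm (f (vector [q1, q2])))\<^sup>2 * (1 / 2 - norm q1 ^ k)\<^sup>2
      \<le> 64 * (real k)\<^sup>2 * bergman_norm2 (hartogs_triangle k) f"
proof -
  let ?H = "hartogs_triangle k"
  define \<sigma> where "\<sigma> = root k (1 / 2)"
  have \<sigma>: "\<sigma> ^ k = 1 / 2" "\<sigma> > 0" using \<open>k > 0\<close> by (simp_all add: \<sigma>_def)
  have "\<sigma> \<le> 1" using \<open>k > 0\<close> by (simp add: \<sigma>_def)
  have q1\<sigma>: "norm q1 < \<sigma>"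
    using q1 \<sigma> by (metis less_imp_le power_less_imp_less_base)
  define \<tau> where "\<tau> = (\<sigma> - norm q1) / 2"
  have \<tau>: "\<tau> > 0" using q1\<sigma> by (simp add: \<tau>_def)
  have "q2 \<noteq> 0" using q2 by auto
  define root_branch where "root_branch w = exp (Ln (w / q2) / of_nat k)" for w
  have near: "norm (w / q2 - 1) < 1 / 2" if "w \<in> ball q2 (1 / 4)" for w
  proof -
    have "w / q2 - 1 = (w - q2) / q2" using \<open>q2 \<noteq> 0\<close> by (simp add: field_simps)
    then have "norm (w / q2 - 1) = norm (w - q2) * 2" by (simp add: norm_divide q2)
    then show ?thesis using that by (simp add: dist_norm norm_minus_commute)
  qed
  have Re_pos: "Re (w / q2) > 1 / 2" if "w \<in> ball q2 (1 / 4)" for w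
    using near[OF that] abs_Re_le_cmod[of "w / q2 - 1"] by (simp add: abs_le_iff)
  have pow: "root_branch w ^ k = w / q2" if "w \<in> ball q2 (1 / 4)" for w
  proof -
    have "w / q2 \<noteq> 0" using Re_pos[OF that] by auto
    moreover have "root_branch w ^ k = exp (Ln (w / q2))"
      using \<open>k > 0\<close> by (simp add: root_branch_def exp_of_nat_mult[symmetric])
    ultimately show ?thesis by (metis exp_Ln)
  qed
  have "(norm (f (vector [q1 * root_branch q2, q2])))\<^sup>2 * (pi * (1 / 4)\<^sup>2) * (pi * \<tau>\<^sup>2) \<le> bergman_norm2 ?H f"
  proof (rule slanted_polydisc_bergman_bound[OF open_hartogs_triangle f])
    have "w / q2 \<notin> \<real>\<^sub>\<le>\<^sub>0" if "w \<in> ball q2 (1 / 4)" for w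
      using Re_pos[OF that] by (auto simp: complex_nonpos_Reals_iff)
    then show "(\<lambda>w. q1 * root_branch w) holomorphic_on ball q2 (1 / 4)"
      unfolding root_branch_def using \<open>q2 \<noteq> 0\<close> \<open>k > 0\<close> by (intro holomorphic_intros) auto
  next
    fix w x assume w: "w \<in> ball q2 (1 / 4)" and x: "x \<in> ball (q1 * root_branch w) \<tau>"
    define m where "m = norm (root_branch w)"
    have mk: "m ^ k = norm w * 2"
      unfolding m_def norm_power[symmetric] pow[OF w] by (simp add: norm_divide q2)
    have "1 / 2 \<le> norm (w / q2)"
      using Re_pos[OF w] complex_Re_le_cmod[of "w / q2"] by linarith
    then have "norm w * 2 \<ge> 1 / 2" by (simp add: norm_divide q2)
    have m2: "m \<ge> 1 / 2"
    proof (rule ccontr)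
      assume "\<not> m \<ge> 1 / 2"
      then have "m ^ k < (1 / 2) ^ k"
        using \<open>k > 0\<close> by (intro power_strict_mono) (auto simp: m_def)
      also have "\<dots> \<le> (1 / 2 :: real) ^ 1" using \<open>k > 0\<close> by (intro power_decreasing) auto
      finally show False using mk \<open>norm w * 2 \<ge> 1 / 2\<close> by simp
    qed
    have "norm x < norm (q1 * root_branch w) + \<tau>"
      using x norm_triangle_ineq2[of x "q1 * root_branch w"] by (simp add: dist_norm norm_minus_commute)
    also have "\<dots> = m * norm q1 + (1 / 2) * (\<sigma> - norm q1)"
      by (simp add: norm_mult m_def \<tau>_def)
    also have "\<dots> \<le> m * norm q1 + m * (\<sigma> - norm q1)"
      using m2 q1\<sigma> by (intro add_left_mono mult_right_mono) auto
    finally have "norm x < m * \<sigma>" by (simp add: algebra_simps)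
    then have "norm x ^ k < (m * \<sigma>) ^ k"
      using \<open>k > 0\<close> by (intro power_strict_mono) auto
    also have "\<dots> = norm w" by (simp add: power_mult_distrib mk \<sigma>)
    finally have "norm x ^ k < norm w" .
    moreover have "norm w < 1"
      using w q2 norm_triangle_ineq2[of w q2] by (simp add: dist_norm norm_minus_commute)
    ultimately show "vector [x, w] \<in> ?H" by (simp add: hartogs_triangle_def)
  qed (use \<tau> in auto)
  moreover have "root_branch q2 = 1" using \<open>q2 \<noteq> 0\<close> by (simp add: root_branch_def)
  ultimately have bound: "(norm (f (vector [q1, q2])))\<^sup>2 * (pi\<^sup>2 * (\<sigma> - norm q1)\<^sup>2) \<le> 64 * bergman_norm2 ?H f"
    by (simp add: \<tau>_def power2_eq_square field_simps)
  have "1 / 2 - norm q1 ^ k \<le> real k * (\<sigma> - norm q1)"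
    using power_diff_le_mult_diff[of "norm q1" \<sigma> k] q1\<sigma> \<open>\<sigma> \<le> 1\<close> \<sigma> by simp
  then have "(1 / 2 - norm q1 ^ k)\<^sup>2 \<le> (real k * (\<sigma> - norm q1))\<^sup>2"
    using q1 by (intro power_mono) auto
  also have "\<dots> \<le> (real k)\<^sup>2 * (pi\<^sup>2 * (\<sigma> - norm q1)\<^sup>2)"
  proof -
    have "(1::real) ^ 2 \<le> pi ^ 2" using pi_gt3 by (intro power_mono) auto
    then have "1 * (\<sigma> - norm q1)\<^sup>2 \<le> pi\<^sup>2 * (\<sigma> - norm q1)\<^sup>2" by (intro mult_right_mono) auto
    then show ?thesis by (simp add: power_mult_distrib mult_left_mono)
  qed
  finally have "(norm (f (vector [q1, q2])))\<^sup>2 * (1 / 2 - norm q1 ^ k)\<^sup>2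
      \<le> (norm (f (vector [q1, q2])))\<^sup>2 * ((real k)\<^sup>2 * (pi\<^sup>2 * (\<sigma> - norm q1)\<^sup>2))"
    by (intro mult_left_mono) auto
  also have "\<dots> = (real k)\<^sup>2 * ((norm (f (vector [q1, q2])))\<^sup>2 * (pi\<^sup>2 * (\<sigma> - norm q1)\<^sup>2))"
    by (simp only: mult_ac)
  also have "\<dots> \<le> (real k)\<^sup>2 * (64 * bergman_norm2 ?H f)"
    by (intro mult_left_mono bound) auto
  finally show ?thesis by (simp add: mult_ac)
qed

text \<open>
  The sets \<open>|z\<^sub>2| < \<epsilon>\<close> shrink to \<open>z\<^sub>2 = 0\<close>, which does not meet the Hartogs triangle.
\<close>

lemma bergman_mass_near_axis:
  fixes f :: "complex ^ 2 \<Rightarrow> complex"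
  assumes f: "f \<in> bergman_space (hartogs_triangle k)" and "\<eta> > (0::real)"
  shows "\<exists>\<epsilon>>0. (\<integral>\<^sup>+z\<in>hartogs_triangle k \<inter> {v. norm (v $ 2) < \<epsilon>}. ennreal ((norm (f z))\<^sup>2) \<partial>lborel) < ennreal \<eta>"
proof -
  let ?H = "hartogs_triangle k"
  define g where "g z = ennreal ((norm (f z))\<^sup>2) * indicator ?H z" for z
  have hol: "holomorphic_several ?H f" using f by (simp add: bergman_space_def)
  have g [measurable]: "g \<in> borel_measurable borel"
    unfolding g_def by (rule bergman_density_measurable[OF open_hartogs_triangle hol])
  define M where "M = density lborel g"
  define A where "A n = {v :: complex ^ 2. norm (v $ 2) < 1 / real (Suc n)}" for n
  have A: "A n \<in> sets borel" for n
    unfolding A_def by (intro borel_open open_Collect_less continuous_intros)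
  have "(\<lambda>n. emeasure M (A n)) \<longlonglongrightarrow> emeasure M (\<Inter>n. A n)"
  proof (rule Lim_emeasure_decseq)
    show "range A \<subseteq> sets M" using A by (auto simp: M_def)
    show "decseq A"
    proof (rule decseq_SucI)
      show "A (Suc n) \<subseteq> A n" for n
        unfolding A_def by (auto elim!: less_le_trans intro!: divide_left_mono)
    qed
    fix n
    have "emeasure M (A n) \<le> (\<integral>\<^sup>+z. g z \<partial>lborel)"
      using A by (subst M_def, subst emeasure_density) (auto intro!: nn_integral_mono split: split_indicator)
    also have "\<dots> < \<infinity>"
      using f unfolding g_def bergman_space_nn_integral(1)[OF open_hartogs_triangle hol] .
    finally show "emeasure M (A n) \<noteq> \<infinity>" by simp
  qed
  moreover have "emeasure M (\<Inter>n. A n) = 0"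
  proof -
    have "g z * indicator (\<Inter>n. A n) z = 0" for z
    proof (cases "z \<in> ?H")
      case True
      then have "norm (z $ 2) > 0"
        unfolding hartogs_triangle_def by (auto intro: le_less_trans[rotated])
      then obtain n where "inverse (real (Suc n)) < norm (z $ 2)" using reals_Archimedean by blast
      then have "z \<notin> A n" by (simp add: A_def inverse_eq_divide)
      then have "z \<notin> (\<Inter>n. A n)" by blast
      then show ?thesis by simp
    qed (simp add: g_def)
    then have "(\<integral>\<^sup>+z\<in>(\<Inter>n. A n). g z \<partial>lborel) = (\<integral>\<^sup>+z. 0 \<partial>(lborel :: (complex ^ 2) measure))"
      by (intro nn_integral_cong)
    then show ?thesis
      using A by (subst M_def, subst emeasure_density) auto
  qed
  ultimately have "(\<lambda>n. emeasure M (A n)) \<longlonglongrightarrow> 0" by simp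
  then have "\<forall>\<^sub>F n in sequentially. emeasure M (A n) < ennreal \<eta>"
    by (rule order_tendstoD) (use \<open>\<eta> > 0\<close> in simp)
  then obtain n where n: "emeasure M (A n) < ennreal \<eta>"
    unfolding eventually_sequentially by blast
  have "emeasure M (A n) = (\<integral>\<^sup>+z\<in>A n. g z \<partial>lborel)"
    using A by (subst M_def, subst emeasure_density) auto
  also have "\<dots> = (\<integral>\<^sup>+z\<in>?H \<inter> {v. norm (v $ 2) < 1 / real (Suc n)}. ennreal ((norm (f z))\<^sup>2) \<partial>lborel)"
    by (intro nn_integral_cong) (auto simp: g_def A_def split: split_indicator)
  finally show ?thesis
    using n by (intro exI[of _ "1 / real (Suc n)"]) simp
qed

text \<open>
  The limit says that \<open>t\<^sup>k f (t z\<^sub>1, t\<^sup>k z\<^sub>2)\<close> has a removable singularity at \<open>0\<close>. Scaling a polydisc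
  around \<open>z\<close> by \<open>t\<close> in the first and \<open>t\<^sup>k\<close> in the second variable gives a polydisc in the domain. Its
  volume scales by \<open>|t|\<^bsup>2 + 2k\<^esup>\<close>, the square of \<open>|t \<cdot> t\<^sup>k|\<close>, while the mass of \<open>f\<close> on it tends to
  zero because it approaches \<open>z\<^sub>2 = 0\<close>.
\<close>

lemma hartogs_orbit_no_pole:
  assumes "k > 0" and f: "f \<in> bergman_space (hartogs_triangle k)" and z: "z \<in> hartogs_triangle k"
  shows "((\<lambda>t. t * (t ^ k * f (vector [t * z $ 1, t ^ k * z $ 2]))) \<longlongrightarrow> 0) (at 0)"
proof (rule tendstoI)
  let ?H = "hartogs_triangle k"
  let ?h = "\<lambda>t. t * (t ^ k * f (vector [t * z $ 1, t ^ k * z $ 2]))"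
  fix e :: real assume e: "e > 0"
  have hol: "holomorphic_several ?H f" using f by (simp add: bergman_space_def)
  have z0: "norm (z $ 2) > 0"
    using z unfolding hartogs_triangle_def by (auto intro: le_less_trans[rotated])
  define U where "U = {v :: complex ^ 2. norm (v $ 1) ^ k < norm (v $ 2) \<and> norm (v $ 2) < 2 * norm (z $ 2)}"
  have "open U" unfolding U_def by (intro open_Collect_conj open_Collect_less continuous_intros)
  moreover have "z \<in> U" using z z0 by (simp add: U_def hartogs_triangle_def)
  ultimately obtain d where d: "d > 0" "ball z d \<subseteq> U" by (meson openE)
  define c where "c = d / 2"
  have c: "c > 0" using d by (simp add: c_def)
  have box: "norm x ^ k < norm y \<and> norm y < 2 * norm (z $ 2)"
    if "norm (x - z $ 1) < c" "norm (y - z $ 2) < c" for x y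
  proof -
    have "norm (z - vector [x, y]) < d"
      using norm_complex_vec2_le[of "z - vector [x, y]"] that by (simp add: c_def norm_minus_commute)
    then have "vector [x, y] \<in> U" using d by (auto simp: dist_norm)
    then show ?thesis by (simp add: U_def)
  qed
  have "e\<^sup>2 * (pi * c\<^sup>2) * (pi * c\<^sup>2) > 0" using e c by simp
  from bergman_mass_near_axis[OF f this] obtain \<epsilon> where \<epsilon>: "\<epsilon> > 0"
    "(\<integral>\<^sup>+z\<in>?H \<inter> {v. norm (v $ 2) < \<epsilon>}. ennreal ((norm (f z))\<^sup>2) \<partial>lborel)
       < ennreal (e\<^sup>2 * (pi * c\<^sup>2) * (pi * c\<^sup>2))" by blast
  let ?\<Omega> = "?H \<inter> {v. norm (v $ 2) < \<epsilon>}"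
  have "open {v :: complex ^ 2. norm (v $ 2) < \<epsilon>}"
    by (intro open_Collect_less continuous_intros)
  then have op: "open ?\<Omega>" using open_hartogs_triangle by blast
  have "((\<lambda>t::complex. norm t ^ k * (2 * norm (z $ 2))) \<longlongrightarrow> norm (0::complex) ^ k * (2 * norm (z $ 2))) (at 0)"
    by (intro tendsto_intros)
  then have "\<forall>\<^sub>F t in at (0::complex). norm t ^ k * (2 * norm (z $ 2)) < min 1 \<epsilon>"
    using \<epsilon>(1) \<open>k > 0\<close> by (intro order_tendstoD(2)[where y = "norm (0::complex) ^ k * (2 * norm (z $ 2))"])
       (auto simp: zero_power)
  moreover have "\<forall>\<^sub>F t in at (0::complex). t \<noteq> 0" by (auto simp: eventually_at_filter)
  ultimately show "\<forall>\<^sub>F t in at 0. dist (?h t) 0 < e"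
  proof eventually_elim
    case (elim t)
    define p where "p = t ^ k * z $ 2"
    have t: "norm t > 0" using elim by simp
    have "ennreal ((norm (f (vector [t * z $ 1, p])))\<^sup>2 * (pi * (c * norm t ^ k)\<^sup>2) * (pi * (c * norm t)\<^sup>2))
        \<le> (\<integral>\<^sup>+z\<in>?\<Omega>. ennreal ((norm (f z))\<^sup>2) \<partial>lborel)"
    proof (rule slanted_polydisc_submean[OF op, where \<phi> = "\<lambda>_. t * z $ 1"])
      show "holomorphic_several ?\<Omega> f" by (rule holomorphic_several_subset[OF hol]) auto
      fix w x assume w: "w \<in> ball p (c * norm t ^ k)" and x: "x \<in> ball (t * z $ 1) (c * norm t)"
      have "norm (x / t - z $ 1) < c"
      proof -
        have "x / t - z $ 1 = (x - t * z $ 1) / t" using t by (auto simp: field_simps)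
        then show ?thesis
          using x t by (simp add: norm_divide dist_norm norm_minus_commute pos_divide_less_eq)
      qed
      moreover have "norm (w / t ^ k - z $ 2) < c"
      proof -
        have "w / t ^ k - z $ 2 = (w - p) / t ^ k" using t by (auto simp: p_def field_simps)
        then show ?thesis
          using w t by (simp add: norm_divide norm_power dist_norm norm_minus_commute pos_divide_less_eq)
      qed
      ultimately have "norm (x / t) ^ k < norm (w / t ^ k)" "norm (w / t ^ k) < 2 * norm (z $ 2)"
        using box by blast+
      then have "norm x ^ k < norm w" "norm w < norm t ^ k * (2 * norm (z $ 2))"
        using t by (simp_all add: norm_divide norm_power power_divide divide_less_cancel pos_divide_less_eq mult.commute)
      then show "vector [x, w] \<in> ?\<Omega>" using elim by (simp add: hartogs_triangle_def)
    qed (use c t in auto)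
    then have "ennreal ((norm (f (vector [t * z $ 1, p])))\<^sup>2 * (pi * (c * norm t ^ k)\<^sup>2) * (pi * (c * norm t)\<^sup>2))
        < ennreal (e\<^sup>2 * (pi * c\<^sup>2) * (pi * c\<^sup>2))"
      using \<epsilon>(2) by (rule le_less_trans)
    also have "(norm (f (vector [t * z $ 1, p])))\<^sup>2 * (pi * (c * norm t ^ k)\<^sup>2) * (pi * (c * norm t)\<^sup>2)
        = (norm (?h t))\<^sup>2 * (pi * c\<^sup>2) * (pi * c\<^sup>2)"
      by (simp add: p_def norm_mult norm_power power_mult_distrib mult_ac)
    finally have "(norm (?h t))\<^sup>2 * (pi * c\<^sup>2) * (pi * c\<^sup>2) < e\<^sup>2 * (pi * c\<^sup>2) * (pi * c\<^sup>2)"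
      by (subst (asm) ennreal_less_iff) auto
    then have "(norm (?h t))\<^sup>2 < e\<^sup>2"
      using c by (simp add: mult_less_cancel_right)
    then show ?case
      using e by (simp add: dist_norm power2_less_imp_less)
  qed
qed

text \<open>
  The maximum principle for the extension of \<open>t\<^sup>k f (t z\<^sub>1, t\<^sup>k z\<^sub>2)\<close> compares \<open>t = 1\<close> with the circle
  \<open>|t| = R\<close> on which \<open>|t\<^sup>k z\<^sub>2| = 1/2\<close>. There \<open>\<rho>\<close> has been multiplied by \<open>R\<^sup>k = 1 / (2|z\<^sub>2|)\<close>, and the
  factor \<open>t\<^sup>k\<close> cancels exactly this gain.
\<close>

lemma hartogs_upper_bound:
  assumes "k > 0" and f: "f \<in> bergman_space (hartogs_triangle k)" and z: "z \<in> hartogs_triangle k"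
    and small: "norm (z $ 2) < 1 / 2"
  shows "(norm (f z))\<^sup>2 * (norm (z $ 2) - norm (z $ 1) ^ k)\<^sup>2
      \<le> 64 * (real k)\<^sup>2 * bergman_norm2 (hartogs_triangle k) f"
proof -
  let ?H = "hartogs_triangle k"
  define s where "s = norm (z $ 2)"
  define \<rho> where "\<rho> = s - norm (z $ 1) ^ k"
  define C where "C = 64 * (real k)\<^sup>2 * bergman_norm2 ?H f"
  have z12: "norm (z $ 1) ^ k < s" using z by (simp add: hartogs_triangle_def s_def)
  have s0: "s > 0" using z12 by (rule le_less_trans[rotated]) simp
  have \<rho>: "\<rho> > 0" using z12 by (simp add: \<rho>_def)
  have C0: "C \<ge> 0" by (simp add: C_def bergman_norm2_nonneg)
  define h where "h t = t ^ k * f (vector [t * z $ 1, t ^ k * z $ 2])" for t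
  define R where "R = root k (1 / (2 * s))"
  \<comment> \<open>The orbit of \<open>z\<close> stays in the domain up to \<open>|t| = R'\<close>, where \<open>|t\<^sup>k z\<^sub>2|\<close> reaches 1.\<close>
  define R' where "R' = root k (1 / s)"
  have Rk: "R ^ k = 1 / (2 * s)" and R'k: "R' ^ k = 1 / s"
    using \<open>k > 0\<close> s0 by (simp_all add: R_def R'_def)
  have R1: "R > 1"
    using \<open>k > 0\<close> s0 small by (simp add: R_def s_def field_simps)
  have RR': "R < R'"
    using \<open>k > 0\<close> s0 by (simp add: R_def R'_def field_simps)
  have inH: "vector [t * z $ 1, t ^ k * z $ 2] \<in> ?H" if "t \<noteq> 0" "norm t < R'" for t
  proof -
    have "norm t ^ k < R' ^ k" using that \<open>k > 0\<close> by (intro power_strict_mono) auto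
    then have "norm t ^ k * s < 1" using s0 by (simp add: R'k field_simps)
    then show ?thesis
      using that z12 by (simp add: hartogs_triangle_def norm_mult norm_power power_mult_distrib s_def)
  qed
  have "(\<lambda>t. f (vector [t * z $ 1, t ^ k * z $ 2])) holomorphic_on ball 0 R' - {0}"
  proof (rule holomorphic_several_curve)
    show "holomorphic_several ?H f" using f by (simp add: bergman_space_def)
    show "(\<lambda>t. vector [t * z $ 1, t ^ k * z $ 2] $ i) holomorphic_on ball 0 R' - {0}" for i :: 2
      using exhaust_2[of i] by (auto intro!: holomorphic_intros)
    show "open (ball (0::complex) R' - {0})" by (intro open_Diff) auto
  qed (simp add: inH)
  then have "h holomorphic_on ball 0 R' - {0}"
    unfolding h_def by (intro holomorphic_on_mult holomorphic_on_power holomorphic_on_ident)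
  moreover have "((\<lambda>t. (t - 0) * h t) \<longlongrightarrow> 0) (at 0)"
    using hartogs_orbit_no_pole[OF \<open>k > 0\<close> f z] by (simp add: h_def)
  moreover have "0 \<in> interior (ball 0 R' :: complex set)" using R1 RR' by simp
  ultimately obtain g where g: "g holomorphic_on ball 0 R'" "\<And>t. t \<in> ball 0 R' - {0} \<Longrightarrow> g t = h t"
    using holomorphic_on_extend_lim[of h "ball 0 R'" 0] by blast
  have on_circle: "norm (g t) \<le> sqrt C / \<rho>" if t: "norm t = R" for t
  proof -
    have "t \<noteq> 0" using t R1 by auto
    have "norm (t ^ k * z $ 2) = 1 / 2"
      using s0 by (simp add: norm_mult norm_power t Rk s_def)
    moreover have q1: "norm (t * z $ 1) ^ k = norm (z $ 1) ^ k / (2 * s)"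
      by (simp add: norm_mult power_mult_distrib t Rk)
    moreover have gap: "1 / 2 - norm (z $ 1) ^ k / (2 * s) = \<rho> / (2 * s)"
      using s0 by (simp add: \<rho>_def field_simps)
    moreover have "\<rho> / (2 * s) > 0" using \<rho> s0 by simp
    ultimately have "(norm (f (vector [t * z $ 1, t ^ k * z $ 2])))\<^sup>2 * (\<rho> / (2 * s))\<^sup>2 \<le> C"
      using hartogs_shell_estimate[OF \<open>k > 0\<close> f, of "t ^ k * z $ 2" "t * z $ 1"] by (simp add: C_def)
    moreover have "norm (g t) = norm (f (vector [t * z $ 1, t ^ k * z $ 2])) / (2 * s)"
      using g(2)[of t] t \<open>t \<noteq> 0\<close> RR' by (simp add: h_def norm_mult norm_power Rk)
    ultimately have "(norm (g t) * \<rho>)\<^sup>2 \<le> C"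
      by (simp add: power_mult_distrib power_divide)
    then have "norm (g t) * \<rho> \<le> sqrt C" by (rule real_le_rsqrt)
    then show ?thesis using \<rho> by (simp add: field_simps)
  qed
  have "norm (g 1) \<le> sqrt C / \<rho>"
  proof (rule maximum_modulus_frontier[of g "cball 0 R"])
    show "g holomorphic_on interior (cball 0 R)"
      by (rule holomorphic_on_subset[OF g(1)]) (use RR' in auto)
    show "continuous_on (closure (cball 0 R)) g"
      by (rule continuous_on_subset[OF holomorphic_on_imp_continuous_on[OF g(1)]]) (use RR' in auto)
  qed (use R1 on_circle in auto)
  moreover have "g 1 = f z" using g(2)[of 1] R1 RR' by (simp add: h_def vec2_eta)
  ultimately have "norm (f z) * \<rho> \<le> sqrt C" using \<rho> by (simp add: field_simps)
  then have "(norm (f z) * \<rho>)\<^sup>2 \<le> (sqrt C)\<^sup>2" using \<rho> by (intro power_mono) auto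
  then show ?thesis
    using C0 by (simp add: power_mult_distrib \<rho>_def s_def C_def)
qed

section \<open>The lower bound on the Hartogs triangle\<close>

lemma nn_integral_has_integral_set:
  fixes f :: "real \<Rightarrow> real"
  assumes "\<And>x. x \<in> S \<Longrightarrow> 0 \<le> f x" and "(f has_integral I) S"
  shows "(\<integral>\<^sup>+x\<in>S. ennreal (f x) \<partial>lborel) = ennreal I"
proof -
  have "(\<integral>\<^sup>+x\<in>S. ennreal (f x) \<partial>lborel) = (\<integral>\<^sup>+x. ennreal (indicator S x * f x) \<partial>lborel)"
    by (intro nn_integral_cong) (simp split: split_indicator)
  then show ?thesis
    using nn_integral_has_integral_lebesgue[OF assms] by simp
qed

text \<open>
  Up to the factor \<open>1 - |b|\<^sup>2\<close> the integrand is the real part of \<open>(1 + u) / (1 - u)\<close> at \<open>u = e\<^bsup>ikt\<^esup> b\<close>,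
  a holomorphic function of \<open>e\<^bsup>it\<^esup> w\<close> for a \<open>k\<close>-th root \<open>w\<close> of \<open>b\<close>, with value 1 at the centre.
\<close>

lemma poisson_circle_integral:
  fixes b :: complex
  assumes "k > 0" "norm b < 1"
  shows "((\<lambda>t. 1 / (norm (1 - cis t ^ k * b))\<^sup>2) has_integral (2 * pi / (1 - (norm b)\<^sup>2))) {0..2*pi}"
proof -
  obtain w where w: "w ^ k = b" using exists_complex_root[of k b] \<open>k > 0\<close> by auto
  have b2: "(norm b)\<^sup>2 < 1" using assms by (simp add: power_less_one_iff abs_square_less_1)
  have "norm w < 1"
    using assms w norm_power[of w k] by (metis linorder_not_le one_le_power)
  have ne: "\<zeta> ^ k \<noteq> 1" if "\<zeta> \<in> ball 0 1" for \<zeta> :: complex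
  proof -
    have "norm (\<zeta> ^ k) < 1" using that \<open>k > 0\<close> by (simp add: norm_power power_less_one_iff)
    then show ?thesis by auto
  qed
  have "(\<lambda>\<zeta>. (1 + \<zeta> ^ k) / (1 - \<zeta> ^ k)) holomorphic_on ball 0 1"
    by (intro holomorphic_intros) (use ne in auto)
  from has_integral_Re[OF holomorphic_circle_mean[OF this \<open>norm w < 1\<close>]]
  have mean: "((\<lambda>t. Re ((1 + cis t ^ k * b) / (1 - cis t ^ k * b))) has_integral (2 * pi)) {0..2*pi}"
    using \<open>k > 0\<close> by (simp add: power_mult_distrib w zero_power)
  have Re: "Re ((1 + u) / (1 - u)) = (1 - (norm u)\<^sup>2) / (norm (1 - u))\<^sup>2" for u :: complex
    unfolding Re_divide cmod_power2 by (simp add: power2_eq_square algebra_simps)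
  have nu: "norm (cis t ^ k * b) = norm b" for t by (simp add: norm_mult norm_power)
  have "((\<lambda>t. (1 / (1 - (norm b)\<^sup>2)) * Re ((1 + cis t ^ k * b) / (1 - cis t ^ k * b)))
      has_integral (1 / (1 - (norm b)\<^sup>2) * (2 * pi))) {0..2*pi}"
    by (rule has_integral_mult_right[OF mean])
  then show ?thesis unfolding Re nu using b2 by simp
qed

text \<open>
  Bounding two of the four factors by their maximum on the circle and integrating the other two exactly
  loses only a constant, whereas bounding all four would cost a full power of \<open>1 - |b|\<close>.
\<close>

lemma circle_integral_fourth_power_le:
  fixes b :: complex
  assumes "k > 0" "norm b < 1"
  shows "(\<integral>\<^sup>+t\<in>{0..2*pi}. ennreal (1 / norm (1 - cis t ^ k * b) ^ 4) \<partial>lborel) \<le> ennreal (2 * pi / (1 - norm b) ^ 3)"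
proof -
  define \<beta> where "\<beta> = norm b"
  have \<beta>: "0 \<le> \<beta>" "\<beta> < 1" using assms by (simp_all add: \<beta>_def)
  have pw: "1 / norm (1 - cis t ^ k * b) ^ 4 \<le> 1 / (1 - \<beta>)\<^sup>2 * (1 / (norm (1 - cis t ^ k * b))\<^sup>2)" for t
  proof -
    have "norm (cis t ^ k * b) = \<beta>" by (simp add: norm_mult norm_power \<beta>_def)
    then have "1 - \<beta> \<le> norm (1 - cis t ^ k * b)"
      using norm_triangle_ineq2[of 1 "cis t ^ k * b"] by simp
    then have "(1 - \<beta>)\<^sup>2 \<le> (norm (1 - cis t ^ k * b))\<^sup>2" using \<beta> by (intro power_mono) auto
    then have "1 / (norm (1 - cis t ^ k * b))\<^sup>2 \<le> 1 / (1 - \<beta>)\<^sup>2"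
      using \<beta> by (intro divide_left_mono mult_pos_pos) (auto intro: less_le_trans[of _ "(1 - \<beta>)\<^sup>2"])
    then have "1 / (norm (1 - cis t ^ k * b))\<^sup>2 * (1 / (norm (1 - cis t ^ k * b))\<^sup>2)
        \<le> 1 / (1 - \<beta>)\<^sup>2 * (1 / (norm (1 - cis t ^ k * b))\<^sup>2)" by (rule mult_right_mono) simp
    then show ?thesis by (simp add: power_add[symmetric])
  qed
  have "(\<integral>\<^sup>+t\<in>{0..2*pi}. ennreal (1 / norm (1 - cis t ^ k * b) ^ 4) \<partial>lborel)
      \<le> (\<integral>\<^sup>+t\<in>{0..2*pi}. ennreal (1 / (1 - \<beta>)\<^sup>2 * (1 / (norm (1 - cis t ^ k * b))\<^sup>2)) \<partial>lborel)"
    by (intro nn_integral_mono mult_right_mono ennreal_leI pw) simp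
  also have "\<dots> = ennreal (1 / (1 - \<beta>)\<^sup>2 * (2 * pi / (1 - \<beta>\<^sup>2)))"
    unfolding \<beta>_def
    by (rule nn_integral_has_integral_set[OF _ has_integral_mult_right[OF poisson_circle_integral[OF assms]]]) simp
  also have "\<dots> \<le> ennreal (2 * pi / (1 - \<beta>) ^ 3)"
  proof (rule ennreal_leI)
    have "1 - \<beta>\<^sup>2 = (1 - \<beta>) * (1 + \<beta>)" by (simp add: power2_eq_square algebra_simps)
    then have "1 / (1 - \<beta>)\<^sup>2 * (2 * pi / (1 - \<beta>\<^sup>2)) = 2 * pi / (1 - \<beta>) ^ 3 / (1 + \<beta>)"
      by (simp add: power2_eq_square power3_eq_cube)
    also have "\<dots> \<le> 2 * pi / (1 - \<beta>) ^ 3"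
    proof -
      have "0 \<le> 2 * pi / (1 - \<beta>) ^ 3" using \<beta> by simp
      from divide_left_mono[of 1 "1 + \<beta>", OF _ this] show ?thesis using \<beta> by simp
    qed
    finally show "1 / (1 - \<beta>)\<^sup>2 * (2 * pi / (1 - \<beta>\<^sup>2)) \<le> 2 * pi / (1 - \<beta>) ^ 3" .
  qed
  finally show ?thesis by (simp add: \<beta>_def)
qed

text \<open>
  In the variable \<open>s = |x|\<^sup>2\<close> the integrand has the antiderivative \<open>s / (1 - \<alpha> \<surd>s / R)\<^sup>2\<close>.
\<close>

lemma nn_integral_disc_inverse_cube:
  fixes \<alpha> R :: real
  assumes "R > 0" "0 \<le> \<alpha>" "\<alpha> < 1"
  shows "(\<integral>\<^sup>+x\<in>ball 0 R. ennreal (1 / (1 - \<alpha> * norm (x::complex) / R) ^ 3) \<partial>lborel) = ennreal (pi * R\<^sup>2 / (1 - \<alpha>)\<^sup>2)"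
proof -
  define u where "u s = \<alpha> * sqrt s / R" for s
  define h where "h s = ennreal (1 / (1 - u s) ^ 3) * indicator {0..<R\<^sup>2} s" for s
  have u1: "u s < 1" if "0 \<le> s" "s \<le> R\<^sup>2" for s
  proof -
    have "sqrt s \<le> R" using that \<open>R > 0\<close> by (simp add: real_sqrt_le_iff real_le_lsqrt)
    then have "\<alpha> * sqrt s \<le> \<alpha> * R" using assms by (intro mult_left_mono) auto
    also have "\<dots> < 1 * R" using assms by (intro mult_strict_right_mono) auto
    finally show ?thesis using \<open>R > 0\<close> by (simp add: u_def)
  qed
  have "(\<integral>\<^sup>+x\<in>ball 0 R. ennreal (1 / (1 - \<alpha> * norm (x::complex) / R) ^ 3) \<partial>lborel) = (\<integral>\<^sup>+x. h ((norm (x::complex))\<^sup>2) \<partial>lborel)"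
  proof (intro nn_integral_cong)
    fix x :: complex
    have "norm x < R \<longleftrightarrow> (norm x)\<^sup>2 < R\<^sup>2"
      using \<open>R > 0\<close> by (auto intro!: power_strict_mono dest: power2_less_imp_less)
    then show "ennreal (1 / (1 - \<alpha> * norm x / R) ^ 3) * indicator (ball 0 R) x = h ((norm x)\<^sup>2)"
      by (simp add: h_def u_def split: split_indicator)
  qed
  also have "\<dots> = ennreal pi * (\<integral>\<^sup>+s\<in>{0..}. h s \<partial>lborel)"
    by (rule nn_integral_complex_radial) (unfold h_def u_def, measurable)
  also have "(\<integral>\<^sup>+s\<in>{0..}. h s \<partial>lborel) = (\<integral>\<^sup>+s\<in>{0..R\<^sup>2}. ennreal (1 / (1 - u s) ^ 3) \<partial>lborel)"
  proof (intro nn_integral_cong_AE)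
    have "AE s in lborel. s \<noteq> R\<^sup>2" by (rule AE_lborel_singleton)
    then show "AE s in lborel. h s * indicator {0..} s = ennreal (1 / (1 - u s) ^ 3) * indicator {0..R\<^sup>2} s"
      by eventually_elim (auto simp: h_def less_le split: split_indicator)
  qed
  also have "\<dots> = ennreal (R\<^sup>2 / (1 - \<alpha>)\<^sup>2)"
  proof (rule nn_integral_has_integral_set)
    show "0 \<le> 1 / (1 - u s) ^ 3" if "s \<in> {0..R\<^sup>2}" for s
      using u1[of s] that by simp
    have "((\<lambda>s. 1 / (1 - u s) ^ 3) has_integral (R\<^sup>2 / (1 - u (R\<^sup>2))\<^sup>2 - 0 / (1 - u 0)\<^sup>2)) {0..R\<^sup>2}"
    proof (rule fundamental_theorem_of_calculus_interior)
      show "continuous_on {0..R\<^sup>2} (\<lambda>s. s / (1 - u s)\<^sup>2)"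
      proof -
        have "1 - \<alpha> * sqrt s / R \<noteq> 0" if "s \<in> {0..R\<^sup>2}" for s
          using u1[of s] that \<open>R > 0\<close> by (auto simp: u_def)
        then show ?thesis
          unfolding u_def using \<open>R > 0\<close> by (auto intro!: continuous_intros)
      qed
      show "((\<lambda>s. s / (1 - u s)\<^sup>2) has_vector_derivative 1 / (1 - u s) ^ 3) (at s)" if s: "s \<in> {0<..<R\<^sup>2}" for s
      proof -
        have ne: "1 - u s \<noteq> 0" using u1[of s] s by auto
        define d where "d = \<alpha> * (inverse (sqrt s) / 2) / R"
        have der_u: "(u has_real_derivative d) (at s)"
          unfolding u_def d_def using s by (auto intro!: derivative_eq_intros)
        have "((\<lambda>s. s / (1 - u s)\<^sup>2) has_real_derivative
            (1 * (1 - u s)\<^sup>2 - s * (2 * (1 - u s) * (0 - d))) / ((1 - u s)\<^sup>2 * (1 - u s)\<^sup>2)) (at s)"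
          using ne by (auto intro!: derivative_eq_intros der_u simp: power2_eq_square)
        also have "s * (2 * (1 - u s) * (0 - d)) = - (1 - u s) * u s"
        proof -
          have "s * inverse (sqrt s) = sqrt s"
            using s by (simp add: divide_inverse[symmetric] real_div_sqrt)
          then have "u s = \<alpha> * (s * inverse (sqrt s)) / R" by (simp add: u_def)
          then have "2 * (s * d) = u s" by (simp add: d_def)
          then have "- (1 - u s) * (2 * (s * d)) = - (1 - u s) * u s" by simp
          then show ?thesis by (simp add: algebra_simps)
        qed
        also have "(1 * (1 - u s)\<^sup>2 - - (1 - u s) * u s) / ((1 - u s)\<^sup>2 * (1 - u s)\<^sup>2) = 1 / (1 - u s) ^ 3"
        proof -
          have "1 * (1 - u s)\<^sup>2 - - (1 - u s) * u s = 1 - u s" by (simp add: power2_eq_square algebra_simps)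
          then show ?thesis using ne by (simp add: power2_eq_square power3_eq_cube)
        qed
        finally show ?thesis by (simp add: has_real_derivative_iff_has_vector_derivative)
      qed
    qed simp
    then show "((\<lambda>s. 1 / (1 - u s) ^ 3) has_integral R\<^sup>2 / (1 - \<alpha>)\<^sup>2) {0..R\<^sup>2}"
      using \<open>R > 0\<close> by (simp add: u_def)
  qed
  also have "ennreal pi * ennreal (R\<^sup>2 / (1 - \<alpha>)\<^sup>2) = ennreal (pi * R\<^sup>2 / (1 - \<alpha>)\<^sup>2)"
    by (simp add: ennreal_mult[symmetric])
  finally show ?thesis .
qed

text \<open>
  In the variable \<open>s = |w|\<^sup>2\<close> the integrand is \<open>s\<^bsup>1/k - 1\<^esup>\<close>, with antiderivative \<open>k s\<^bsup>1/k\<^esup>\<close>. At \<open>w = 0\<close> it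
  takes the harmless value \<open>0\<close>.
\<close>

lemma nn_integral_disc_root:
  assumes "k > 0"
  shows "(\<integral>\<^sup>+w\<in>ball 0 1. ennreal ((root k (norm (w::complex)))\<^sup>2 / (norm w)\<^sup>2) \<partial>lborel) = ennreal (pi * k)"
proof -
  define h where "h s = ennreal (root k s / s) * indicator {0..<1} s" for s :: real
  have rk: "(root k x)\<^sup>2 = root k (x\<^sup>2)" for x :: real
    using assms by (simp add: real_root_power)
  have "(\<integral>\<^sup>+w\<in>ball 0 1. ennreal ((root k (norm (w::complex)))\<^sup>2 / (norm w)\<^sup>2) \<partial>lborel)
      = (\<integral>\<^sup>+w. h ((norm (w::complex))\<^sup>2) \<partial>lborel)"
    by (intro nn_integral_cong) (auto simp: h_def rk abs_square_less_1 split: split_indicator)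
  also have "\<dots> = ennreal pi * (\<integral>\<^sup>+s\<in>{0..}. h s \<partial>lborel)"
  proof (rule nn_integral_complex_radial)
    have "root k \<in> borel_measurable borel"
      by (intro borel_measurable_continuous_onI continuous_at_imp_continuous_on ballI isCont_real_root)
    then show "h \<in> borel_measurable borel" unfolding h_def by measurable
  qed
  also have "(\<integral>\<^sup>+s\<in>{0..}. h s \<partial>lborel) = (\<integral>\<^sup>+s\<in>{0..1}. ennreal (root k s / s) \<partial>lborel)"
  proof (intro nn_integral_cong_AE)
    have "AE s::real in lborel. s \<noteq> 1" by (rule AE_lborel_singleton)
    then show "AE s in lborel. h s * indicator {0..} s = ennreal (root k s / s) * indicator {0..1} s"
      by eventually_elim (auto simp: h_def split: split_indicator)
  qed
  also have "\<dots> = ennreal (real k)"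
  proof (rule nn_integral_has_integral_set)
    show "0 \<le> root k s / s" if "s \<in> {0..1}" for s
      using that assms by simp
    have "((\<lambda>s. root k s / s) has_integral (real k * root k 1 - real k * root k 0)) {0..1}"
    proof (rule fundamental_theorem_of_calculus_interior)
      show "continuous_on {0..1} (\<lambda>s. real k * root k s)"
        by (intro continuous_intros continuous_at_imp_continuous_on ballI isCont_real_root)
      show "((\<lambda>s. real k * root k s) has_vector_derivative root k s / s) (at s)" if s: "s \<in> {0<..<1}" for s
      proof -
        have "root k s * root k s ^ (k - 1) = root k s ^ k"
          using assms by (simp flip: power_Suc)
        then have "root k s * root k s ^ (k - 1) = s" using s assms by simp
        moreover have "root k s ^ (k - 1) \<noteq> 0" using s assms by simp
        ultimately have eq: "real k * inverse (real k * root k s ^ (k - Suc 0)) = root k s / s"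
          using s assms by (simp add: field_simps)
        have "((\<lambda>s. real k * root k s) has_real_derivative real k * inverse (real k * root k s ^ (k - Suc 0))) (at s)"
          using s assms by (intro DERIV_cmult DERIV_real_root) auto
        then show ?thesis unfolding eq by (simp add: has_real_derivative_iff_has_vector_derivative)
      qed
    qed simp
    then show "((\<lambda>s. root k s / s) has_integral real k) {0..1}" using assms by simp
  qed
  finally show ?thesis by (simp add: ennreal_mult)
qed


text \<open>
  With \<open>\<zeta> = v\<^sub>1\<^sup>k / v\<^sub>2\<close> this is \<open>v\<^sub>2\<^sup>-\<^sup>1 (1 - a \<zeta>)\<^sup>-\<^sup>2\<close>, a multiple of the Bergman kernel function of the unit
  disc in the variable \<open>\<zeta>\<close>.
\<close>

definition hartogs_test_function :: "nat \<Rightarrow> complex \<Rightarrow> complex ^ 2 \<Rightarrow> complex"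
  where "hartogs_test_function k a v = v $ 2 * inverse ((v $ 2 - a * v $ 1 ^ k)\<^sup>2)"

lemma holomorphic_hartogs_test_function:
  assumes "norm a < 1"
  shows "holomorphic_several (hartogs_triangle k) (hartogs_test_function k a)"
  unfolding hartogs_test_function_def[abs_def]
proof (intro holomorphic_several_mult holomorphic_several_inverse holomorphic_several_power
    holomorphic_several_diff holomorphic_several_const holomorphic_several_nth)
  fix v assume v: "v \<in> hartogs_triangle k"
  have "norm (a * v $ 1 ^ k) \<le> 1 * norm (v $ 1) ^ k"
    unfolding norm_mult norm_power using assms by (intro mult_right_mono) auto
  also have "\<dots> < norm (v $ 2)" using v by (simp add: hartogs_triangle_def)
  finally show "(v $ 2 - a * v $ 1 ^ k)\<^sup>2 \<noteq> 0" by auto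
qed

text \<open>
  Averaging over circles replaces \<open>|1 - a \<zeta>|\<^sup>-\<^sup>4\<close> by at most \<open>(1 - |a| |\<zeta>|)\<^sup>-\<^sup>3\<close>. On the fibre, of radius
  \<open>R = |w|\<^bsup>1/k\<^esup>\<close>, one has \<open>|\<zeta>| = (|x| / R)\<^sup>k \<le> |x| / R\<close>, and the remaining radial integral is explicit.
\<close>

lemma hartogs_test_function_fibre_integral:
  assumes "k > 0" "norm a < 1" and w: "0 < norm w" "norm w < 1"
  shows "(\<integral>\<^sup>+x. ennreal ((norm (hartogs_test_function k a (vector [x, w])))\<^sup>2) *
            indicator (hartogs_triangle k) (vector [x, w]) \<partial>lborel)
      \<le> ennreal (pi / (1 - norm a)\<^sup>2) * ennreal ((root k (norm w))\<^sup>2 / (norm w)\<^sup>2)"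
proof -
  define R where "R = root k (norm w)"
  have R: "R > 0" "R ^ k = norm w" using assms by (simp_all add: R_def)
  have mem: "vector [x, w] \<in> hartogs_triangle k \<longleftrightarrow> norm x < R" for x
  proof -
    have "norm x < R \<longleftrightarrow> norm x ^ k < R ^ k"
      using power_strict_mono[of "norm x" R k] power_less_imp_less_base[of "norm x" k R] \<open>k > 0\<close> R(1) by auto
    then show ?thesis using w by (simp add: hartogs_triangle_def R)
  qed
  define g where "g x = ennreal ((norm (hartogs_test_function k a (vector [x, w])))\<^sup>2) *
            indicator (hartogs_triangle k) (vector [x, w])" for x
  have g_eq: "g x = ennreal (1 / (norm w)\<^sup>2) * ennreal (1 / norm (1 - a * x ^ k / w) ^ 4) * indicator (ball 0 R) x" for x
  proof -
    have "hartogs_test_function k a (vector [x, w]) = 1 / (w * (1 - a * x ^ k / w)\<^sup>2)"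
    proof -
      have "w - a * x ^ k = w * (1 - a * x ^ k / w)" using w by (auto simp: field_simps)
      then show ?thesis
        using w by (simp add: hartogs_test_function_def power_mult_distrib divide_inverse power2_eq_square)
    qed
    then have "(norm (hartogs_test_function k a (vector [x, w])))\<^sup>2
        = 1 / (norm w)\<^sup>2 * (1 / norm (1 - a * x ^ k / w) ^ 4)"
      by (simp add: norm_divide norm_mult norm_power power_divide power_mult_distrib flip: power_mult)
    then show ?thesis
      unfolding g_def by (simp add: mem ennreal_mult[symmetric] split: split_indicator)
  qed
  have [measurable]: "ball (0::complex) R \<in> sets borel" by simp
  have g [measurable]: "g \<in> borel_measurable borel"
    unfolding g_eq[abs_def] by measurable
  have avg: "(\<integral>\<^sup>+t\<in>{0..2*pi}. g (cis t * x) \<partial>lborel)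
      \<le> ennreal (2 * pi) * (ennreal (1 / (norm w)\<^sup>2) * (ennreal (1 / (1 - norm a * norm x / R) ^ 3) * indicator (ball 0 R) x))" for x
  proof (cases "norm x < R")
    case False
    then have "g (cis t * x) = 0" for t by (simp add: g_eq norm_mult)
    then show ?thesis by simp
  next
    case True
    define b where "b = a * x ^ k / w"
    have nb: "norm b \<le> norm a * norm x / R"
    proof -
      have "norm b = norm a * (norm x / R) ^ k"
        by (simp add: b_def norm_divide norm_mult norm_power power_divide R)
      also have "\<dots> \<le> norm a * (norm x / R) ^ 1"
        using True R \<open>k > 0\<close> by (intro mult_left_mono power_decreasing) auto
      finally show ?thesis by simp
    qed
    have lt1: "norm a * norm x / R < 1"
    proof -
      have "norm a * norm x \<le> 1 * norm x" using assms by (intro mult_right_mono) auto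
      then show ?thesis using True R by (simp add: divide_less_eq)
    qed
    have "g (cis t * x) = ennreal (1 / (norm w)\<^sup>2) * ennreal (1 / norm (1 - cis t ^ k * b) ^ 4)" for t
      using True by (simp add: g_eq b_def norm_mult power_mult_distrib mult_ac)
    then have "(\<integral>\<^sup>+t\<in>{0..2*pi}. g (cis t * x) \<partial>lborel)
        = (\<integral>\<^sup>+t. ennreal (1 / (norm w)\<^sup>2) * (ennreal (1 / norm (1 - cis t ^ k * b) ^ 4) * indicator {0..2*pi} t) \<partial>lborel)"
      by (simp add: mult.assoc)
    also have "\<dots> = ennreal (1 / (norm w)\<^sup>2) * (\<integral>\<^sup>+t\<in>{0..2*pi}. ennreal (1 / norm (1 - cis t ^ k * b) ^ 4) \<partial>lborel)"
    proof (rule nn_integral_cmult)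
      have [measurable]: "cis \<in> borel_measurable borel"
        by (intro borel_measurable_continuous_onI continuous_intros)
      show "(\<lambda>t. ennreal (1 / norm (1 - cis t ^ k * b) ^ 4) * indicator {0..2*pi} t) \<in> borel_measurable lborel"
        by measurable
    qed
    also have "\<dots> \<le> ennreal (1 / (norm w)\<^sup>2) * ennreal (2 * pi / (1 - norm b) ^ 3)"
      using nb lt1 by (intro mult_left_mono circle_integral_fourth_power_le \<open>k > 0\<close>) auto
    also have "\<dots> \<le> ennreal (1 / (norm w)\<^sup>2) * ennreal (2 * pi * (1 / (1 - norm a * norm x / R) ^ 3))"
    proof (intro mult_left_mono ennreal_leI)
      have "(1 - norm a * norm x / R) ^ 3 \<le> (1 - norm b) ^ 3"
        using nb lt1 by (intro power_mono) auto
      then show "2 * pi / (1 - norm b) ^ 3 \<le> 2 * pi * (1 / (1 - norm a * norm x / R) ^ 3)"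
        using nb lt1 by (simp add: divide_left_mono)
    qed simp
    also have "\<dots> = ennreal (2 * pi) * (ennreal (1 / (norm w)\<^sup>2) * (ennreal (1 / (1 - norm a * norm x / R) ^ 3) * indicator (ball 0 R) x))"
      using True lt1 by (simp add: ennreal_mult[symmetric])
    finally show ?thesis .
  qed
  have "ennreal (2 * pi) * (\<integral>\<^sup>+x. g x \<partial>lborel) = (\<integral>\<^sup>+x. (\<integral>\<^sup>+t\<in>{0..2*pi}. g (cis t * x) \<partial>lborel) \<partial>lborel)"
    by (rule nn_integral_circle_average[symmetric]) fact
  also have "\<dots> \<le> (\<integral>\<^sup>+x. ennreal (2 * pi) * (ennreal (1 / (norm w)\<^sup>2) *
      (ennreal (1 / (1 - norm a * norm (x::complex) / R) ^ 3) * indicator (ball 0 R) x)) \<partial>lborel)"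
    by (rule nn_integral_mono) (rule avg)
  also have "\<dots> = ennreal (2 * pi) * (ennreal (1 / (norm w)\<^sup>2) *
      (\<integral>\<^sup>+x\<in>ball 0 R. ennreal (1 / (1 - norm a * norm (x::complex) / R) ^ 3) \<partial>lborel))"
  proof -
    have m: "(\<lambda>x::complex. ennreal (1 / (1 - norm a * norm x / R) ^ 3) * indicator (ball 0 R) x) \<in> borel_measurable lborel"
      by measurable
    show ?thesis
      using nn_integral_cmult[OF m, of "ennreal (2 * pi) * ennreal (1 / (norm w)\<^sup>2)"] by (simp only: mult.assoc)
  qed
  also have "(\<integral>\<^sup>+x\<in>ball 0 R. ennreal (1 / (1 - norm a * norm (x::complex) / R) ^ 3) \<partial>lborel) = ennreal (pi * R\<^sup>2 / (1 - norm a)\<^sup>2)"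
    using R assms by (intro nn_integral_disc_inverse_cube) auto
  finally have "(\<integral>\<^sup>+x. g x \<partial>lborel) \<le> ennreal (1 / (norm w)\<^sup>2) * ennreal (pi * R\<^sup>2 / (1 - norm a)\<^sup>2)"
    by (subst (asm) ennreal_mult_le_mult_iff) auto
  then show ?thesis
    unfolding g_def R_def by (simp add: ennreal_mult[symmetric] mult_ac)
qed

lemma hartogs_test_function_norm:
  assumes "k > 0" "norm a < 1"
  shows "hartogs_test_function k a \<in> bergman_space (hartogs_triangle k)"
    and "bergman_norm2 (hartogs_triangle k) (hartogs_test_function k a) \<le> real k * pi\<^sup>2 / (1 - norm a)\<^sup>2"
proof -
  let ?H = "hartogs_triangle k" and ?f = "hartogs_test_function k a"
  note hol = holomorphic_hartogs_test_function[OF assms(2), of k]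
  have root_meas: "root k \<in> borel_measurable borel"
    by (intro borel_measurable_continuous_onI continuous_at_imp_continuous_on ballI isCont_real_root)
  have "(\<integral>\<^sup>+v\<in>?H. ennreal ((norm (?f v))\<^sup>2) \<partial>lborel)
      = (\<integral>\<^sup>+w. \<integral>\<^sup>+x. ennreal ((norm (?f (vector [x, w])))\<^sup>2) * indicator ?H (vector [x, w]) \<partial>lborel \<partial>lborel)"
    by (rule nn_integral_complex_vec2) (rule bergman_density_measurable[OF open_hartogs_triangle hol])
  also have "\<dots> \<le> (\<integral>\<^sup>+w. ennreal (pi / (1 - norm a)\<^sup>2) *
      (ennreal ((root k (norm (w::complex)))\<^sup>2 / (norm w)\<^sup>2) * indicator (ball 0 1) w) \<partial>lborel)"
  proof (rule nn_integral_mono)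
    fix w :: complex
    show "(\<integral>\<^sup>+x. ennreal ((norm (?f (vector [x, w])))\<^sup>2) * indicator ?H (vector [x, w]) \<partial>lborel)
        \<le> ennreal (pi / (1 - norm a)\<^sup>2) * (ennreal ((root k (norm w))\<^sup>2 / (norm w)\<^sup>2) * indicator (ball 0 1) w)"
    proof (cases "0 < norm w \<and> norm w < 1")
      case True
      then show ?thesis using hartogs_test_function_fibre_integral[OF assms, of w] by simp
    next
      case False
      have "vector [x, w] \<notin> ?H" for x
      proof
        assume "vector [x, w] \<in> ?H"
        then have "norm x ^ k < norm w" "norm w < 1" by (simp_all add: hartogs_triangle_def)
        moreover have "0 \<le> norm x ^ k" by simp
        ultimately show False using False by linarith
      qed
      then show ?thesis by simp
    qed
  qed
  also have "\<dots> = ennreal (pi / (1 - norm a)\<^sup>2) *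
      (\<integral>\<^sup>+w\<in>ball 0 1. ennreal ((root k (norm (w::complex)))\<^sup>2 / (norm w)\<^sup>2) \<partial>lborel)"
  proof (rule nn_integral_cmult)
    note [measurable] = root_meas
    have [measurable]: "ball (0::complex) 1 \<in> sets borel" by simp
    show "(\<lambda>w::complex. ennreal ((root k (norm w))\<^sup>2 / (norm w)\<^sup>2) * indicator (ball 0 1) w) \<in> borel_measurable lborel"
      by measurable
  qed
  also have "\<dots> = ennreal (real k * pi\<^sup>2 / (1 - norm a)\<^sup>2)"
    unfolding nn_integral_disc_root[OF assms(1)]
    using assms by (simp add: ennreal_mult[symmetric] power2_eq_square mult_ac)
  finally have le: "(\<integral>\<^sup>+v\<in>?H. ennreal ((norm (?f v))\<^sup>2) \<partial>lborel) \<le> ennreal (real k * pi\<^sup>2 / (1 - norm a)\<^sup>2)" .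
  then show fA: "?f \<in> bergman_space ?H"
    by (subst bergman_space_nn_integral(1)[OF open_hartogs_triangle hol]) (auto simp: less_top[symmetric] top_unique)
  show "bergman_norm2 ?H ?f \<le> real k * pi\<^sup>2 / (1 - norm a)\<^sup>2"
    using le by (simp add: bergman_space_nn_integral(2)[OF open_hartogs_triangle hol fA])
qed

text \<open>
  The parameter \<open>a\<close> is the conjugate of \<open>z\<^sub>1\<^sup>k / z\<^sub>2\<close>, so that the test function peaks at \<open>z\<close>:
  \<open>|f z| = |z\<^sub>2|\<^sup>-\<^sup>1 (1 - |a|\<^sup>2)\<^sup>-\<^sup>2\<close>, against a squared norm of order \<open>(1 - |a|)\<^sup>-\<^sup>2\<close>. The quotient has the
  right size because \<open>\<rho> = |z\<^sub>2| (1 - |a|)\<close>.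
\<close>

lemma hartogs_lower_bound:
  assumes "k > 0" and z: "z \<in> hartogs_triangle k"
  shows "\<exists>f\<in>bergman_space (hartogs_triangle k). f z \<noteq> 0 \<and>
    bergman_norm2 (hartogs_triangle k) f
      \<le> 16 * real k * pi\<^sup>2 * (norm (z $ 2) - norm (z $ 1) ^ k)\<^sup>2 * (norm (f z))\<^sup>2"
proof -
  define s where "s = norm (z $ 2)"
  define a where "a = cnj (z $ 1 ^ k / z $ 2)"
  define \<alpha> where "\<alpha> = norm a"
  let ?f = "hartogs_test_function k a"
  have z12: "norm (z $ 1) ^ k < s" using z by (simp add: hartogs_triangle_def s_def)
  have s0: "s > 0" using z12 by (rule le_less_trans[rotated]) simp
  have \<alpha>_eq: "\<alpha> = norm (z $ 1) ^ k / s" by (simp add: \<alpha>_def a_def norm_divide norm_power s_def)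
  have \<alpha>: "0 \<le> \<alpha>" "\<alpha> < 1" using z12 s0 by (simp_all add: \<alpha>_eq)
  have rho: "norm (z $ 2) - norm (z $ 1) ^ k = s * (1 - \<alpha>)"
    using s0 by (simp add: \<alpha>_eq s_def field_simps)
  have "a * z $ 1 ^ k = z $ 2 * (z $ 1 ^ k / z $ 2 * a)"
    using s0 by (auto simp: s_def)
  also have "z $ 1 ^ k / z $ 2 * a = of_real (\<alpha>\<^sup>2)"
    unfolding \<alpha>_def a_def complex_mod_cnj by (rule complex_norm_square[symmetric])
  finally have "z $ 2 - a * z $ 1 ^ k = z $ 2 * of_real (1 - \<alpha>\<^sup>2)"
    by (simp add: algebra_simps)
  moreover have \<alpha>2: "1 - \<alpha>\<^sup>2 = (1 - \<alpha>) * (1 + \<alpha>)" by (simp add: power2_eq_square algebra_simps)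
  moreover have pos: "(1 - \<alpha>) * (1 + \<alpha>) > 0" using \<alpha> by (intro mult_pos_pos) auto
  ultimately have "norm (z $ 2 - a * z $ 1 ^ k) = s * ((1 - \<alpha>) * (1 + \<alpha>))"
    by (simp only: norm_mult norm_of_real s_def)
  then have "norm (?f z) = s / (s * ((1 - \<alpha>) * (1 + \<alpha>)))\<^sup>2"
    by (simp add: hartogs_test_function_def norm_mult norm_inverse norm_power s_def divide_inverse)
  then have fz: "norm (?f z) = 1 / (s * ((1 - \<alpha>) * (1 + \<alpha>))\<^sup>2)"
    using s0 by (simp add: power_mult_distrib power2_eq_square[of s])
  have "bergman_norm2 (hartogs_triangle k) ?f \<le> real k * pi\<^sup>2 / (1 - \<alpha>)\<^sup>2"
    unfolding \<alpha>_def by (rule hartogs_test_function_norm) (use assms \<alpha> in \<open>auto simp: \<alpha>_def\<close>)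
  also have "\<dots> \<le> 16 * real k * pi\<^sup>2 * (s * (1 - \<alpha>))\<^sup>2 * (norm (?f z))\<^sup>2"
  proof -
    have "(1 + \<alpha>) ^ 4 \<le> 2 ^ 4" using \<alpha> by (intro power_mono) auto
    then have "1 \<le> 16 / (1 + \<alpha>) ^ 4" using \<alpha> by simp
    then have "real k * pi\<^sup>2 / (1 - \<alpha>)\<^sup>2 * 1 \<le> real k * pi\<^sup>2 / (1 - \<alpha>)\<^sup>2 * (16 / (1 + \<alpha>) ^ 4)"
      by (intro mult_left_mono) auto
    also have "\<dots> = 16 * real k * pi\<^sup>2 * (s * (1 - \<alpha>))\<^sup>2 * (norm (?f z))\<^sup>2"
    proof -
      have "(s * (1 - \<alpha>))\<^sup>2 * (norm (?f z))\<^sup>2 = (s * (1 - \<alpha>) * norm (?f z))\<^sup>2"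
        by (simp add: power_mult_distrib)
      also have "s * (1 - \<alpha>) * norm (?f z) = 1 / ((1 - \<alpha>) * (1 + \<alpha>)\<^sup>2)"
        using s0 \<alpha> by (simp add: fz power2_eq_square)
      also have "\<dots>\<^sup>2 = 1 / ((1 - \<alpha>)\<^sup>2 * (1 + \<alpha>) ^ 4)"
        by (simp add: power_divide power_mult_distrib flip: power_mult)
      finally show ?thesis by (simp add: mult.assoc)
    qed
    finally show ?thesis by simp
  qed
  finally have "bergman_norm2 (hartogs_triangle k) ?f
      \<le> 16 * real k * pi\<^sup>2 * (norm (z $ 2) - norm (z $ 1) ^ k)\<^sup>2 * (norm (?f z))\<^sup>2"
    by (simp only: rho)
  moreover have "?f z \<noteq> 0"
  proof -
    have "norm (?f z) > 0" unfolding fz using s0 pos \<alpha> by (intro divide_pos_pos mult_pos_pos zero_less_power) auto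
    then show ?thesis by auto
  qed
  moreover have "?f \<in> bergman_space (hartogs_triangle k)"
    by (rule hartogs_test_function_norm) (use assms \<alpha> in \<open>auto simp: \<alpha>_def\<close>)
  ultimately show ?thesis by blast
qed

theorem theorem4p9:
  fixes k :: nat
  assumes "k > 0"
  shows "\<exists>K::real. K \<ge> 1 \<and> (\<exists>r>0. \<forall>z\<in>hartogs_triangle k. norm z < r \<longrightarrow>
           bergman_kernel (hartogs_triangle k) z z \<in> \<real> \<and>
           inverse K * boundary_distance (hartogs_triangle k) z powi (-2)
             \<le> Re (bergman_kernel (hartogs_triangle k) z z) \<and>
           Re (bergman_kernel (hartogs_triangle k) z z)
             \<le> K * boundary_distance (hartogs_triangle k) z powi (-2))"
proof -
  let ?H = "hartogs_triangle k"
  \<comment> \<open>\<open>A\<close> comes from the upper bound; \<open>D\<close> from the lower one, with \<open>\<rho> \<le> (1 + k) \<delta>\<close> taken into account.\<close>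
  define A where "A = 64 * (real k)\<^sup>2"
  define D where "D = 16 * real k * pi\<^sup>2 * (1 + real k)\<^sup>2"
  define K where "K = max 1 (max A D)"
  have K: "K \<ge> 1" "A \<le> K" "D \<le> K" by (auto simp: K_def)
  have A0: "A \<ge> 0" by (simp add: A_def)
  have D0: "D > 0" using assms by (simp add: D_def)
  have ev: "bounded_evaluation ?H"
    by (rule open_bounded_evaluation_vec2[OF open_hartogs_triangle])
  have "bergman_kernel ?H z z \<in> \<real> \<and>
      inverse K * boundary_distance ?H z powi (-2) \<le> Re (bergman_kernel ?H z z) \<and>
      Re (bergman_kernel ?H z z) \<le> K * boundary_distance ?H z powi (-2)"
    if z: "z \<in> ?H" and small: "norm z < 1 / 2" for z
  proof (intro conjI)
    define \<rho> where "\<rho> = norm (z $ 2) - norm (z $ 1) ^ k"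
    define \<delta> where "\<delta> = boundary_distance ?H z"
    define B where "B = Re (bergman_kernel ?H z z)"
    have \<rho>: "\<rho> > 0" using z by (simp add: \<rho>_def hartogs_triangle_def)
    have \<delta>\<rho>: "\<delta> \<le> \<rho>" "\<rho> \<le> (1 + real k) * \<delta>"
      using hartogs_boundary_distance[OF assms z small] by (simp_all add: \<delta>_def \<rho>_def)
    have \<delta>: "\<delta> > 0"
    proof (rule ccontr)
      assume "\<not> \<delta> > 0"
      then have "(1 + real k) * \<delta> \<le> 0" by (intro mult_nonneg_nonpos) auto
      then show False using \<rho> \<delta>\<rho>(2) by linarith
    qed
    have powi: "boundary_distance ?H z powi (-2) = 1 / \<delta>\<^sup>2"
      by (simp add: \<delta>_def power_int_minus_divide)
    have z2: "norm (z $ 2) < 1 / 2"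
      using small Finite_Cartesian_Product.norm_nth_le[of z 2] by linarith
    note diagonal = bergman_kernel_diagonal[OF ev z]
    show "bergman_kernel ?H z z \<in> \<real>" by (rule diagonal(1))
    have "B \<le> A / \<rho>\<^sup>2"
      unfolding B_def
    proof (rule diagonal(3))
      show "(norm (f z))\<^sup>2 \<le> A / \<rho>\<^sup>2 * bergman_norm2 ?H f" if "f \<in> bergman_space ?H" for f
        using hartogs_upper_bound[OF assms that z z2] \<rho> by (simp add: A_def \<rho>_def[symmetric] field_simps)
    qed (use A0 in simp)
    also have "\<dots> \<le> K / \<delta>\<^sup>2"
      using \<delta> \<delta>\<rho>(1) K A0 by (intro frac_le power_mono) auto
    finally show "Re (bergman_kernel ?H z z) \<le> K * boundary_distance ?H z powi (-2)"
      unfolding powi B_def by simp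
    obtain f where f: "f \<in> bergman_space ?H" "f z \<noteq> 0"
      and le: "bergman_norm2 ?H f \<le> 16 * real k * pi\<^sup>2 * \<rho>\<^sup>2 * (norm (f z))\<^sup>2"
      using hartogs_lower_bound[OF assms z] by (auto simp: \<rho>_def)
    have "(norm (f z))\<^sup>2 \<le> B * bergman_norm2 ?H f"
      unfolding B_def by (rule diagonal(2)[OF f(1)])
    moreover have "0 < (norm (f z))\<^sup>2" using f by simp
    ultimately have "B * bergman_norm2 ?H f > 0" by linarith
    then have "B > 0"
      using bergman_norm2_nonneg[of ?H f] by (simp add: zero_less_mult_iff)
    have "16 * real k * pi\<^sup>2 * \<rho>\<^sup>2 \<le> 16 * real k * pi\<^sup>2 * ((1 + real k) * \<delta>)\<^sup>2"
      using \<rho> \<delta>\<rho>(2) by (intro mult_left_mono power_mono) auto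
    also have "\<dots> = D * \<delta>\<^sup>2" by (simp add: D_def power_mult_distrib)
    also have "\<dots> \<le> K * \<delta>\<^sup>2" by (intro mult_right_mono K) simp
    finally have "bergman_norm2 ?H f \<le> K * \<delta>\<^sup>2 * (norm (f z))\<^sup>2"
      using le by (meson mult_right_mono order_trans zero_le_power2)
    then have "B * bergman_norm2 ?H f \<le> B * (K * \<delta>\<^sup>2 * (norm (f z))\<^sup>2)"
      using \<open>B > 0\<close> by (intro mult_left_mono) auto
    with \<open>(norm (f z))\<^sup>2 \<le> B * bergman_norm2 ?H f\<close>
    have "1 * (norm (f z))\<^sup>2 \<le> (B * (K * \<delta>\<^sup>2)) * (norm (f z))\<^sup>2" by (simp add: mult_ac)
    then have "1 \<le> B * (K * \<delta>\<^sup>2)"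
      using \<open>0 < (norm (f z))\<^sup>2\<close> by (rule mult_right_le_imp_le)
    then show "inverse K * boundary_distance ?H z powi (-2) \<le> Re (bergman_kernel ?H z z)"
      unfolding powi B_def[symmetric] using K(1) \<delta> by (simp add: field_simps)
  qed
  then show ?thesis
    using K(1) by (intro exI[of _ K] conjI exI[of _ "1 / 2"]) auto
qed

end
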